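(* Let $I\subset\mathbb R$ be an interval, let $G(t,x)=f(t)^\top x-f_0(t)$ for $t\in I$, $x\in\mathbb R^n$, where $f(t)=(f_1(t),\dots,f_n(t))^\top$ and $f_0,f_1,\dots,f_n$ are real-valued, let $\rho$ be a probability density on $\mathbb R^n$, and let $t^*\in I$. Suppose $f$ and $f_0$ are continuously differentiable in a neighborhood of $t^*$ and the $2\times n$ matrix $D=\begin{pmatrix}f(t^* )^\top\\ f'(t^* )^\top\end{pmatrix}$ has full rank. Let $J\in\mathbb R^{n\times(n-2)}$ satisfy $DJ=0_{2\times(n-2)}$ and $J^\top J=I_{(n-2)\times(n-2)}$, and set $$W=D^\top(DD^\top)^{-1}\begin{pmatrix}f_0(t^* )\\ f_0'(t^* )\end{pmatrix},\qquad Z=\begin{pmatrix}f'(t^* )-\dfrac{f(t^* )^\top f'(t^* )}{f(t^* )^\top f(t^* )}f(t^* ) & J\end{pmatrix}\in\mathbb R^{n\times(n-1)},$$ $$S=\frac{f'(t^* )^\top f'(t^* )\,f(t^* )^\top f(t^* )-(f'(t^* )^\top f(t^* ))^2}{f(t^* )^\top f(t^* )}.$$ Then $$T(t^* )=\frac{S^{3/2}}{\|f(t^* )\|}\int_{\mathbb R^{n-1}}\rho(W+Z\mu)\,|\mu_1|\,d\mu.$$ Furthermore, if $\rho(x)=\hat\rho(x^\top x)$ is radial, then $$T(t^* )=\frac{S^{3/2}}{\|f(t^* )\|}\int_{\mathbb R^{n-1}}\hat\rho\big(U+2q\mu_1+S\mu_1^2+\|\mu_{2:n-1}\|^2\big)\,|\mu_1|\,d\mu,$$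 where $$U=W^\top W=\frac{\|f_0(t^* )f'(t^* )-f_0'(t^* )f(t^* )\|^2}{S\|f(t^* )\|^2},\qquad q=f_0'(t^* )-\frac{f(t^* )^\top f'(t^* )}{f(t^* )^\top f(t^* )}f_0(t^* ).$$
   Context: $T(t^* )=\int_{\{x\in\mathbb R^n\mid G(t^*,x)=0\}}\rho(x)\frac{|G'(t^*,x)|}{\|\nabla G(t^*,x)\|}\,d\mathbb H^{n-1}$, where $G'$ is the derivative in $t$, $\nabla G$ the gradient in $x$, $\|\cdot\|$ the Euclidean norm and $\mathbb H^{n-1}$ the $(n-1)$-dimensional Hausdorff measure. For $\mu=(\mu_1,\dots,\mu_{n-1})\in\mathbb R^{n-1}$, $\mu_{2:n-1}=(\mu_2,\dots,\mu_{n-1})$. *)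

theory Defs
  imports "HOL-Analysis.Analysis"
begin

text \<open>Cost of a single covering set: the volume of the k-dimensional ball of the same diameter.
  The case distinction only matters for k = 0 (counting measure), where a power 0 equals 1.\<close>

definition hausdorff_gauge :: "nat \<Rightarrow> 'a::metric_space set \<Rightarrow> ennreal" where
  "hausdorff_gauge k C =
     (if C = {} then 0 else ennreal (unit_ball_vol (real k) * (diameter C / 2) ^ k))"

text \<open>Boundedness is required explicitly because \<^const>\<open>diameter\<close> is unspecified on
  unbounded sets.\<close>

definition hausdorff_premeasure :: "nat \<Rightarrow> real \<Rightarrow> 'a::metric_space set \<Rightarrow> ennreal" where
  "hausdorff_premeasure k \<delta> A =
     (INF C \<in> {C :: nat \<Rightarrow> 'a set.
                 A \<subseteq> (\<Union>i. C i) \<and> (\<forall>i. bounded (C i) \<and> diameter (C i) \<le> \<delta>)}.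
        (\<Sum>i. hausdorff_gauge k (C i)))"

definition hausdorff_outer :: "nat \<Rightarrow> 'a::metric_space set \<Rightarrow> ennreal" where
  "hausdorff_outer k A = (SUP \<delta> \<in> {0<..}. hausdorff_premeasure k \<delta> A)"

text \<open>The outer measure is a metric outer measure, hence countably additive on the Borel sets
  (Caratheodory's criterion), so \<^const>\<open>measure_of\<close> returns its restriction to them. The ball
  volume factor in the gauge is the standard normalisation, for which the k-dimensional measure
  on a k-dimensional Euclidean space is Lebesgue measure.\<close>

definition hausdorff_measure :: "nat \<Rightarrow> 'a::metric_space measure" where
  "hausdorff_measure k = measure_of UNIV (sets borel) (hausdorff_outer k)"

definition gradient :: "('a::real_inner \<Rightarrow> real) \<Rightarrow> 'a \<Rightarrow> 'a" where
  "gradient g x = (THE D. GDERIV g x :> D)"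

text \<open>Derivatives with respect to time are taken within the interval I, so that they are
  one-sided at an endpoint of I and ordinary derivatives at interior points.\<close>

definition C1_near :: "real set \<Rightarrow> real \<Rightarrow> (real \<Rightarrow> 'a::real_normed_vector) \<Rightarrow> bool" where
  "C1_near I t g \<longleftrightarrow>
     (\<exists>U. open U \<and> t \<in> U \<and>
          (\<forall>s \<in> U \<inter> I. g differentiable (at s within I)) \<and>
          continuous_on (U \<inter> I) (\<lambda>s. vector_derivative g (at s within I)))"

text \<open>The integrand is non-negative for a density \<open>\<rho>\<close>, and the integral may be infinite, hence
  the value in \<^typ>\<open>ennreal\<close>.\<close>

definition level_set_integral ::
    "real set \<Rightarrow> (real \<Rightarrow> real ^ 'n \<Rightarrow> real) \<Rightarrow> (real ^ 'n \<Rightarrow> real) \<Rightarrow> real \<Rightarrow> ennreal" where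
  "level_set_integral I G \<rho> t =
     (\<integral>\<^sup>+ x \<in> {x. G t x = 0}.
        ennreal (\<rho> x * (\<bar>vector_derivative (\<lambda>s. G s x) (at t within I)\<bar> / norm (gradient (G t) x)))
      \<partial>hausdorff_measure (CARD('n) - 1))"

definition prob_density :: "('a::euclidean_space \<Rightarrow> real) \<Rightarrow> bool" where
  "prob_density \<rho> \<longleftrightarrow>
     \<rho> \<in> borel_measurable borel \<and> (\<forall>x. 0 \<le> \<rho> x) \<and> (\<integral>\<^sup>+ x. ennreal (\<rho> x) \<partial>lborel) = 1"

text \<open>A real matrix with n rows and m columns, where m may be 0 (which no index type can
  express), is given by its columns, a function on the indices 1, ..., m. Correspondingly a vector
  in m-dimensional space is a function on these indices, and Lebesgue measure on that space is the
  product measure.\<close>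

definition mult_columns :: "nat \<Rightarrow> (nat \<Rightarrow> real ^ 'n) \<Rightarrow> (nat \<Rightarrow> real) \<Rightarrow> real ^ 'n" where
  "mult_columns m Z \<mu> = (\<Sum>i = 1..m. \<mu> i *\<^sub>R Z i)"

abbreviation lebesgue_space :: "nat \<Rightarrow> (nat \<Rightarrow> real) measure" where
  "lebesgue_space m \<equiv> Pi\<^sub>M {1..m} (\<lambda>_. lborel)"

end

theory Submission
  imports Defs
begin

text \<open>At time \<open>t\<close> the level set is the hyperplane \<open>a \<bullet> x = b\<close>, the gradient of \<open>G t\<close> is the constant
\<open>a\<close>, and the time derivative of \<open>G\<close> at \<open>x\<close> is \<open>a' \<bullet> x - b'\<close>. The first column of \<open>Z\<close> is the
component of \<open>a'\<close> orthogonal to \<open>a\<close> and has length \<open>sqrt S\<close>; the other columns are orthonormal and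
orthogonal to \<open>a\<close> and \<open>a'\<close>. As \<open>W\<close> solves \<open>a \<bullet> W = b\<close> and \<open>a' \<bullet> W = b'\<close>, the map
\<open>\<mu> \<mapsto> W + Z \<mu>\<close> parametrises the hyperplane, and along it the time derivative is \<open>S * \<mu> 1\<close>. After
division of the first column by its length the parametrisation is isometric, so the
change of variables costs the factor \<open>sqrt S\<close>, and \<open>sqrt S * S / norm a\<close> is the constant in the
formula. The radial version and the closed form of \<open>U\<close> follow by expanding inner products, since
\<open>W\<close> lies in the span of \<open>a\<close> and \<open>a'\<close>.

The substance lies in the step that an isometric parametrisation by a \<open>k\<close>-dimensional Euclidean
space carries Lebesgue measure to \<open>k\<close>-dimensional Hausdorff measure
(\<open>nn_integral_hausdorff_isometric_range\<close>). It has three ingredients. The Hausdorff outer measure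
is additive on sets at positive distance, so by Caratheodory's criterion it is a measure on the
Borel sets (\<open>metric_outer_measure_borel\<close>). It is invariant under isometries
(\<open>hausdorff_outer_isometric_image\<close>). Finally, on a \<open>k\<close>-dimensional Euclidean space it equals
Lebesgue measure, including the normalising constant (\<open>hausdorff_outer_eq_lborel\<close>): one inequality
exhausts an open set by small disjoint balls using Vitali's theorem, and the other says that a set
of diameter \<open>d\<close> has at most the volume of a ball of diameter \<open>d\<close>, which is the isodiametric
inequality. The latter is derived from the Prekopa-Leindler inequality, by induction on the
dimension.\<close>

section \<open>The isodiametric inequality\<close>

text \<open>Monotone limits along such a sequence recover a whole set \<open>A\<close> from its truncations at
elements of \<open>A\<close>, whether or not \<open>A\<close> is bounded or contains its supremum.\<close>

lemma cofinal_sequence_real: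
  fixes A :: "real set"
  assumes "A \<noteq> {}"
  obtains a where "incseq a" "range a \<subseteq> A" "\<And>x. x \<in> A \<Longrightarrow> \<exists>n. x \<le> a n"
proof (cases "\<exists>m\<in>A. \<forall>x\<in>A. x \<le> m")
  case True
  then obtain m where "m \<in> A" "\<forall>x\<in>A. x \<le> m" by blast
  then show thesis
    by (intro that[of "\<lambda>_. m"]) (auto simp: incseq_def)
next
  case False
  obtain D where D: "countable D" "D \<subseteq> A" "A \<subseteq> closure D"
    using separable by blast
  have "D \<noteq> {}" using D(3) assms by auto
  define d where "d = from_nat_into D"
  have d: "range d = D" using D(1) \<open>D \<noteq> {}\<close> by (simp add: d_def range_from_nat_into)
  define a where "a n = Max (d ` {..n})" for n
  have a_in: "a n \<in> d ` {..n}" for n unfolding a_def by (intro Max_in) auto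
  show thesis
  proof (rule that[of a])
    show "incseq a"
      by (auto simp: incseq_def a_def intro!: Max_mono)
    show "range a \<subseteq> A" using a_in d D(2) by blast
    fix x assume "x \<in> A"
    with False obtain y where y: "y \<in> A" "x < y" by force
    then have "y \<in> closure D" using D(3) by auto
    then obtain e where e: "e \<in> D" "dist e y < y - x"
      using y(2) by (metis closure_approachable diff_gt_0_iff_gt)
    then obtain n where n: "e = d n" using d by blast
    have "x \<le> e" using e(2) by (auto simp: dist_real_def)
    also have "e \<le> a n" unfolding a_def n by (intro Max_ge) auto
    finally show "\<exists>n. x \<le> a n" by blast
  qed
qed

lemma emeasure_lborel_shift:
  fixes A :: "'a::euclidean_space set"
  assumes "A \<in> sets borel"
  shows "emeasure lborel {x. x - c \<in> A} = emeasure lborel A"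
proof -
  have "emeasure lborel A = emeasure (distr lborel borel ((+) (- c))) A"
    by (simp add: lborel_distr_plus)
  also have "\<dots> = emeasure lborel ((+) (- c) -` A)"
    using assms by (subst emeasure_distr) auto
  also have "(+) (- c) -` A = {x. x - c \<in> A}" by auto
  finally show ?thesis by simp
qed

text \<open>The one-dimensional Brunn-Minkowski inequality. For \<open>a\<close> in \<open>A\<close> and \<open>b\<close> in \<open>B\<close>, the part of \<open>A\<close> up
to \<open>a\<close>, moved by \<open>b\<close>, lies to the left of \<open>a + b\<close>, and the part of \<open>B\<close> from \<open>b\<close> on, moved by \<open>a\<close>,
lies to its right. Both are contained in the sumset and share at most one point. Letting \<open>a\<close>
increase and \<open>b\<close> decrease through cofinal sequences exhausts \<open>A\<close> and \<open>B\<close>. The set \<open>C\<close> is an arbitrary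
Borel set containing the sumset because the sumset of two Borel sets may fail to be Borel.\<close>

lemma emeasure_sumset_real:
  fixes A B C :: "real set"
  assumes [measurable]: "A \<in> sets borel" "B \<in> sets borel" "C \<in> sets borel"
    and ne: "A \<noteq> {}" "B \<noteq> {}"
    and sum: "\<And>a b. a \<in> A \<Longrightarrow> b \<in> B \<Longrightarrow> a + b \<in> C"
  shows "emeasure lborel A + emeasure lborel B \<le> emeasure lborel C"
proof -
  have half: "emeasure lborel (A \<inter> {..a}) + emeasure lborel (B \<inter> {b..}) \<le> emeasure lborel C"
    if ab: "a \<in> A" "b \<in> B" for a b
  proof -
    let ?S = "{x. x - b \<in> A \<inter> {..a}}" and ?T = "{x. x - a \<in> B \<inter> {b..}}"
    have [measurable]: "?S \<in> sets borel" "?T \<in> sets borel" by measurable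
    have "emeasure lborel (A \<inter> {..a}) + emeasure lborel (B \<inter> {b..})
        = emeasure lborel ?S + emeasure lborel ?T"
      by (simp only: emeasure_lborel_shift[of "A \<inter> {..a}"] emeasure_lborel_shift[of "B \<inter> {b..}"]
            assms sets.Int atMost_borel atLeast_borel)
    also have "emeasure lborel ?S = emeasure lborel (?S - {a + b})"
      by (intro emeasure_Diff_null_set[symmetric]) (auto intro: countable_imp_null_set_lborel)
    also have "emeasure lborel (?S - {a + b}) + emeasure lborel ?T
        = emeasure lborel ((?S - {a + b}) \<union> ?T)"
      by (intro plus_emeasure) auto
    also have "\<dots> \<le> emeasure lborel C"
    proof (intro emeasure_mono)
      show "(?S - {a + b}) \<union> ?T \<subseteq> C"
        using sum[of "_ - b" b] sum[of a "_ - a"] ab by auto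
    qed auto
    finally show ?thesis .
  qed
  obtain a where a: "incseq a" "range a \<subseteq> A" "\<And>x. x \<in> A \<Longrightarrow> \<exists>n. x \<le> a n"
    using cofinal_sequence_real[OF ne(1)] by blast
  obtain b where b: "incseq b" "range b \<subseteq> uminus ` B" "\<And>x. x \<in> uminus ` B \<Longrightarrow> \<exists>n. x \<le> b n"
    using cofinal_sequence_real[of "uminus ` B"] ne(2) by blast
  have "(\<lambda>n. emeasure lborel (A \<inter> {..a n})) \<longlonglongrightarrow> emeasure lborel (\<Union>n. A \<inter> {..a n})"
    using a(1) by (intro Lim_emeasure_incseq) (auto simp: incseq_def intro: order_trans)
  also have "(\<Union>n. A \<inter> {..a n}) = A" using a(3) by auto
  finally have 1: "(\<lambda>n. emeasure lborel (A \<inter> {..a n})) \<longlonglongrightarrow> emeasure lborel A" .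
  have "(\<lambda>n. emeasure lborel (B \<inter> {- b n..})) \<longlonglongrightarrow> emeasure lborel (\<Union>n. B \<inter> {- b n..})"
    using b(1) by (intro Lim_emeasure_incseq) (auto simp: incseq_def intro: order_trans[rotated])
  also have "(\<Union>n. B \<inter> {- b n..}) = B" using b(3) by (force simp: minus_le_iff)
  finally have 2: "(\<lambda>n. emeasure lborel (B \<inter> {- b n..})) \<longlonglongrightarrow> emeasure lborel B" .
  show ?thesis
  proof (rule LIMSEQ_le_const2[OF tendsto_add[OF 1 2]], intro exI allI impI)
    fix n
    have "b n \<in> uminus ` B" using b(2) by blast
    then have "a n \<in> A" "- b n \<in> B" using a(2) by auto
    then show "emeasure lborel (A \<inter> {..a n}) + emeasure lborel (B \<inter> {- b n..}) \<le> emeasure lborel C"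
      by (rule half)
  qed
qed

text \<open>Both sides are the measure of the region under the graph of \<open>f\<close>, integrated in
the two possible orders.\<close>

lemma nn_integral_layer_cake:
  fixes f :: "real \<Rightarrow> ennreal"
  assumes [measurable]: "f \<in> borel_measurable borel" and le1: "\<And>x. f x \<le> 1"
  shows "(\<integral>\<^sup>+ x. f x \<partial>lborel) =
    (\<integral>\<^sup>+ u. indicator {0<..<1} u * emeasure lborel {x. ennreal u < f x} \<partial>lborel)"
proof -
  let ?k = "\<lambda>x u::real. indicator {0<..<1} u * indicator {z. ennreal u < f z} x :: ennreal"
  have [measurable]: "(\<lambda>(x,u). ?k x u) \<in> borel_measurable (borel \<Otimes>\<^sub>M borel)"
    unfolding indicator_def by measurable
  have inner: "(\<integral>\<^sup>+ u. ?k x u \<partial>lborel) = f x" for x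
  proof -
    obtain r where r: "f x = ennreal r" "0 \<le> r" "r \<le> 1"
      using le1[of x] by (cases "f x") (auto simp: top_unique)
    have "?k x u = indicator {0<..<r} u" for u
      using r by (auto simp: indicator_def ennreal_less_iff)
    then show ?thesis using r by simp
  qed
  have "(\<integral>\<^sup>+ x. f x \<partial>lborel) = (\<integral>\<^sup>+ x. \<integral>\<^sup>+ u. ?k x u \<partial>lborel \<partial>lborel)"
    by (simp add: inner)
  also have "\<dots> = (\<integral>\<^sup>+ u. \<integral>\<^sup>+ x. ?k x u \<partial>lborel \<partial>lborel)"
    by (rule lborel_pair.Fubini'[symmetric]) measurable
  also have "\<dots> = (\<integral>\<^sup>+ u. indicator {0<..<1} u * emeasure lborel {x. ennreal u < f x} \<partial>lborel)"
    by (subst nn_integral_cmult) auto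
  finally show ?thesis .
qed

text \<open>When \<open>f\<close> and \<open>g\<close> both have supremum 1, all their superlevel sets at heights \<open>u < 1\<close> are nonempty, and
the sum of two of them lies in the superlevel set of \<open>h\<close> at the same height. The one-dimensional
Brunn-Minkowski inequality for each \<open>u\<close>, integrated over \<open>u\<close>, gives the claim.\<close>

lemma prekopa_leindler_real_normalised:
  fixes f g h :: "real \<Rightarrow> ennreal"
  assumes [measurable]: "f \<in> borel_measurable borel" "g \<in> borel_measurable borel"
      "h \<in> borel_measurable borel"
    and le1: "\<And>x. f x \<le> 1" "\<And>x. g x \<le> 1"
    and sup: "\<And>c. c < 1 \<Longrightarrow> \<exists>x. c < f x" "\<And>c. c < 1 \<Longrightarrow> \<exists>x. c < g x"
    and fgh: "\<And>x y. f x * g y \<le> (h (x + y))\<^sup>2"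
  shows "(\<integral>\<^sup>+ x. f x \<partial>lborel) + (\<integral>\<^sup>+ x. g x \<partial>lborel) \<le> (\<integral>\<^sup>+ x. h x \<partial>lborel)"
proof -
  let ?L = "\<lambda>f u. indicator {0<..<1} u * emeasure lborel {x. ennreal u < f x}"
  have meas: "(\<lambda>u. ?L k u) \<in> borel_measurable borel"
    if [measurable]: "k \<in> borel_measurable borel" for k :: "real \<Rightarrow> ennreal"
  proof -
    have "(\<lambda>u. emeasure lborel (Pair u -` {z \<in> space (borel \<Otimes>\<^sub>M lborel). ennreal (fst z) < k (snd z)})) 
        \<in> borel_measurable borel"
      by (rule lborel.measurable_emeasure_Pair) measurable
    also have "(\<lambda>u::real. Pair u -` {z \<in> space (borel \<Otimes>\<^sub>M lborel). ennreal (fst z) < k (snd z)})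
       = (\<lambda>u. {x. ennreal u < k x})"
      by (auto simp: space_pair_measure fun_eq_iff)
    finally have [measurable]: "(\<lambda>u. emeasure lborel {x. ennreal u < k x}) \<in> borel_measurable borel"
      by (simp add: fun_eq_iff)
    show ?thesis by measurable
  qed
  have "(\<integral>\<^sup>+ x. f x \<partial>lborel) + (\<integral>\<^sup>+ x. g x \<partial>lborel)
      = (\<integral>\<^sup>+ u. ?L f u \<partial>lborel) + (\<integral>\<^sup>+ u. ?L g u \<partial>lborel)"
    using le1 by (simp add: nn_integral_layer_cake)
  also have "\<dots> = (\<integral>\<^sup>+ u. ?L f u + ?L g u \<partial>lborel)"
    using meas by (intro nn_integral_add[symmetric]) auto
  also have "\<dots> \<le> (\<integral>\<^sup>+ u. ?L (\<lambda>x. min 1 (h x)) u \<partial>lborel)"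
  proof (intro nn_integral_mono)
    fix u :: real
    show "?L f u + ?L g u \<le> ?L (\<lambda>x. min 1 (h x)) u"
    proof (cases "u \<in> {0<..<1}")
      case True
      then have u1: "ennreal u < 1" by simp
      have "emeasure lborel {x. ennreal u < f x} + emeasure lborel {x. ennreal u < g x}
          \<le> emeasure lborel {x. ennreal u < min 1 (h x)}"
      proof (rule emeasure_sumset_real)
        show "{x. ennreal u < f x} \<noteq> {}" "{x. ennreal u < g x} \<noteq> {}"
          using sup u1 by blast+
        fix a b assume "a \<in> {x. ennreal u < f x}" "b \<in> {x. ennreal u < g x}"
        then have "(ennreal u)\<^sup>2 < (h (a + b))\<^sup>2"
        proof -
          assume "a \<in> {x. ennreal u < f x}" "b \<in> {x. ennreal u < g x}"
          then have "ennreal u * ennreal u < f a * ennreal u" "f a * ennreal u \<le> f a * g b"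
            using True by (auto intro!: ennreal_mult_strict_right_mono mult_left_mono)
          then show ?thesis using fgh[of a b] by (simp add: power2_eq_square)
        qed
        then have "ennreal u < h (a + b)"
          by (meson leD leI power_mono zero_le)
        then show "a + b \<in> {x. ennreal u < min 1 (h x)}" using u1 by simp
      qed measurable
      then show ?thesis using True by simp
    qed simp
  qed
  also have "\<dots> = (\<integral>\<^sup>+ x. min 1 (h x) \<partial>lborel)"
    by (simp add: nn_integral_layer_cake)
  also have "\<dots> \<le> (\<integral>\<^sup>+ x. h x \<partial>lborel)"
    by (intro nn_integral_mono) auto
  finally show ?thesis .
qed

lemma ennreal_arith_geo_mean: "4 * (x * y) \<le> (x + y)\<^sup>2" for x y :: ennreal
proof (cases "x = top \<or> y = top")
  case True
  then show ?thesis by (auto simp: power2_eq_square)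
next
  case False
  then obtain r s where rs: "x = ennreal r" "y = ennreal s" "0 \<le> r" "0 \<le> s"
    by (metis ennreal_cases)
  have "4 * (r * s) \<le> (r + s)\<^sup>2"
    using zero_le_power2[of "r - s"] by (simp add: power2_eq_square algebra_simps)
  then have "ennreal (4 * (r * s)) \<le> ennreal ((r + s)\<^sup>2)" by (rule ennreal_leI)
  then show ?thesis using rs by (simp add: ennreal_mult ennreal_power ennreal_plus[symmetric] del: ennreal_plus)
qed

text \<open>Dividing \<open>f\<close> and \<open>g\<close> by their suprema \<open>m\<close> and \<open>l\<close>, and \<open>h\<close> by \<open>sqrt (m * l)\<close>, preserves the
hypothesis and reduces the claim to the normalised case; the resulting bound on a sum of integrals
implies the bound on their product by the inequality of arithmetic and geometric means. Both the
hypothesis and the conclusion are stated with squares, and with \<open>x + y\<close> in place of the midpoint, so that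
neither roots nor halves of elements of \<^typ>\<open>ennreal\<close> occur.\<close>

lemma prekopa_leindler_real_bounded:
  fixes f g h :: "real \<Rightarrow> ennreal"
  assumes [measurable]: "f \<in> borel_measurable borel" "g \<in> borel_measurable borel"
      "h \<in> borel_measurable borel"
    and bdd: "\<And>x. f x \<le> of_nat N" "\<And>x. g x \<le> of_nat N"
    and fgh: "\<And>x y. f x * g y \<le> (h (x + y))\<^sup>2"
  shows "4 * ((\<integral>\<^sup>+ x. f x \<partial>lborel) * (\<integral>\<^sup>+ x. g x \<partial>lborel)) \<le> (\<integral>\<^sup>+ x. h x \<partial>lborel)\<^sup>2"
proof (cases "(\<forall>x. f x = 0) \<or> (\<forall>x. g x = 0)")
  case True
  then show ?thesis by auto
next
  case False
  have norm: "\<exists>m>0. (SUP x. k x) = ennreal m"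
    if kN: "\<And>x. k x \<le> of_nat N" and k0: "\<not> (\<forall>x. k x = 0)" for k :: "real \<Rightarrow> ennreal"
  proof -
    obtain x where "0 < k x" using k0 by (auto simp: zero_less_iff_neq_zero)
    also have "k x \<le> (SUP x. k x)" by (rule SUP_upper) simp
    finally have 0: "0 < (SUP x. k x)" .
    have "(SUP x. k x) \<le> of_nat N" using kN by (rule SUP_least)
    then have "(SUP x. k x) < top" by (rule le_less_trans) (rule of_nat_less_top)
    with 0 show ?thesis by (cases "SUP x. k x") (auto simp: less_top)
  qed
  obtain m l where m: "0 < m" "(SUP x. f x) = ennreal m" and l: "0 < l" "(SUP x. g x) = ennreal l"
    using norm[of f] norm[of g] bdd False by blast
  define r where "r = sqrt (m * l)"
  have r: "0 < r" "r\<^sup>2 = m * l" using m l by (auto simp: r_def)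
  have scale: "ennreal (1/s) * k x \<le> 1" "c < 1 \<Longrightarrow> \<exists>x. c < ennreal (1/s) * k x"
    if s: "0 < s" "(SUP x. k x) = ennreal s" for k :: "real \<Rightarrow> ennreal" and s x c
  proof -
    have "k x \<le> ennreal s" by (metis s(2) SUP_upper UNIV_I)
    then have "ennreal (1/s) * k x \<le> ennreal (1/s) * ennreal s" by (rule mult_left_mono) simp
    also have "\<dots> = 1" using s(1) by (simp add: ennreal_mult[symmetric])
    finally show "ennreal (1/s) * k x \<le> 1" .
    assume c: "c < 1"
    show "\<exists>x. c < ennreal (1/s) * k x"
    proof (rule ccontr)
      assume "\<not> ?thesis"
      then have "(SUP x. ennreal (1/s) * k x) \<le> c" by (intro SUP_least) (auto simp: not_less)
      also have "(SUP x. ennreal (1/s) * k x) = ennreal (1/s) * ennreal s"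
        by (simp add: SUP_mult_left_ennreal s(2)[symmetric])
      also have "\<dots> = 1" using s(1) by (simp add: ennreal_mult[symmetric])
      finally show False using c by simp
    qed
  qed
  have "(\<integral>\<^sup>+ x. ennreal (1/m) * f x \<partial>lborel) + (\<integral>\<^sup>+ x. ennreal (1/l) * g x \<partial>lborel)
      \<le> (\<integral>\<^sup>+ x. ennreal (1/r) * h x \<partial>lborel)"
  proof (rule prekopa_leindler_real_normalised)
    fix x y
    have "ennreal (1/m) * f x * (ennreal (1/l) * g y) = ennreal (1/m) * ennreal (1/l) * (f x * g y)"
      by (simp add: mult_ac)
    also have "ennreal (1/m) * ennreal (1/l) = (ennreal (1/r))\<^sup>2"
      using m l r by (simp add: ennreal_mult[symmetric] ennreal_power power_one_over)
    also have "(ennreal (1/r))\<^sup>2 * (f x * g y) \<le> (ennreal (1/r))\<^sup>2 * (h (x + y))\<^sup>2"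
      by (intro mult_left_mono fgh) simp
    finally show "ennreal (1/m) * f x * (ennreal (1/l) * g y) \<le> (ennreal (1/r) * h (x + y))\<^sup>2"
      by (simp add: power_mult_distrib)
  qed (use scale[OF m] scale[OF l] in auto)
  then have *: "ennreal (1/m) * integral\<^sup>N lborel f + ennreal (1/l) * integral\<^sup>N lborel g
      \<le> ennreal (1/r) * integral\<^sup>N lborel h"
    by (simp add: nn_integral_cmult)
  have rr: "(ennreal r)\<^sup>2 = ennreal m * ennreal l"
    using r m l by (simp add: ennreal_power ennreal_mult)
  have inv: "ennreal s * (ennreal (1/s) * X) = X" if "0 < s" for s X
    using that by (simp add: mult.assoc[symmetric] ennreal_mult[symmetric])
  have "4 * (integral\<^sup>N lborel f * integral\<^sup>N lborel g)
      = 4 * ((ennreal m * (ennreal (1/m) * integral\<^sup>N lborel f)) * 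
             (ennreal l * (ennreal (1/l) * integral\<^sup>N lborel g)))"
    using m l by (simp only: inv)
  also have "\<dots> = (ennreal r)\<^sup>2 * 
      (4 * ((ennreal (1/m) * integral\<^sup>N lborel f) * (ennreal (1/l) * integral\<^sup>N lborel g)))"
    unfolding rr by (simp only: mult_ac)
  also have "\<dots> \<le> (ennreal r)\<^sup>2 * (ennreal (1/r) * integral\<^sup>N lborel h)\<^sup>2"
    by (intro mult_left_mono order_trans[OF ennreal_arith_geo_mean] power_mono *) auto
  also have "\<dots> = (integral\<^sup>N lborel h)\<^sup>2"
    using r by (simp only: power_mult_distrib[symmetric] inv)
  finally show ?thesis .
qed

lemma nn_integral_truncate:
  fixes f :: "'a \<Rightarrow> ennreal"
  assumes [measurable]: "f \<in> borel_measurable M"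
  shows "(\<integral>\<^sup>+ x. f x \<partial>M) = (SUP N. \<integral>\<^sup>+ x. min (f x) (of_nat N) \<partial>M)"
proof -
  have "(SUP N. min (f x) (of_nat N)) = f x" for x
  proof (rule antisym)
    show "f x \<le> (SUP N. min (f x) (of_nat N))"
    proof (cases "f x = top")
      case True
      then show ?thesis by (simp add: ennreal_SUP_of_nat_eq_top)
    next
      case False
      then obtain N where "f x < of_nat N" using ennreal_Ex_less_of_nat
        by (metis less_top)
      then have "f x = min (f x) (of_nat N)" by simp
      also have "\<dots> \<le> (SUP N. min (f x) (of_nat N))" by (rule SUP_upper) simp
      finally show ?thesis .
    qed
  qed (auto intro: SUP_least)
  then have "(\<integral>\<^sup>+ x. f x \<partial>M) = (\<integral>\<^sup>+ x. (SUP N. min (f x) (of_nat N)) \<partial>M)" by simp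
  also have "\<dots> = (SUP N. \<integral>\<^sup>+ x. min (f x) (of_nat N) \<partial>M)"
    by (intro nn_integral_monotone_convergence_SUP)
       (auto simp: incseq_def le_fun_def min_le_iff_disj intro: order_trans[OF _ of_nat_mono])
  finally show ?thesis .
qed

lemma prekopa_leindler_real:
  fixes f g h :: "real \<Rightarrow> ennreal"
  assumes [measurable]: "f \<in> borel_measurable borel" "g \<in> borel_measurable borel"
      "h \<in> borel_measurable borel"
    and fgh: "\<And>x y. f x * g y \<le> (h (x + y))\<^sup>2"
  shows "4 * ((\<integral>\<^sup>+ x. f x \<partial>lborel) * (\<integral>\<^sup>+ x. g x \<partial>lborel)) \<le> (\<integral>\<^sup>+ x. h x \<partial>lborel)\<^sup>2"
proof -
  \<comment> \<open>Truncations are bounded, and independent truncation levels allow the two suprema to be taken one after the other.\<close>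
  let ?F = "\<lambda>N. \<integral>\<^sup>+ x. min (f x) (of_nat N) \<partial>lborel"
  let ?G = "\<lambda>N. \<integral>\<^sup>+ x. min (g x) (of_nat N) \<partial>lborel"
  have le: "4 * (?F N * ?G K) \<le> (integral\<^sup>N lborel h)\<^sup>2" for N K
  proof -
    have "min (f x) (of_nat N) * min (g y) (of_nat K) \<le> (h (x + y))\<^sup>2" for x y
      by (rule order_trans[OF mult_mono fgh]) auto
    moreover have "min (f x) (of_nat N) \<le> of_nat (max N K)" "min (g x) (of_nat K) \<le> of_nat (max N K)" for x
      by (auto simp: min_le_iff_disj)
    ultimately show ?thesis
      by (intro prekopa_leindler_real_bounded[where N="max N K"]) auto
  qed
  have "integral\<^sup>N lborel f = (SUP N. ?F N)" "integral\<^sup>N lborel g = (SUP N. ?G N)"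
    by (rule nn_integral_truncate; simp)+
  then have "4 * (integral\<^sup>N lborel f * integral\<^sup>N lborel g) = 4 * ((SUP N. ?F N) * (SUP N. ?G N))"
    by (simp only:)
  also have "\<dots> = (SUP K. SUP N. 4 * (?F N * ?G K))"
    by (simp add: SUP_mult_left_ennreal SUP_mult_right_ennreal)
  also have "\<dots> \<le> (integral\<^sup>N lborel h)\<^sup>2"
    by (intro SUP_least le)
  finally show ?thesis .
qed

interpretation lborel_product: product_sigma_finite "\<lambda>_. lborel :: real measure"
  by standard

text \<open>Induction on the number of coordinates. For fixed values \<open>s\<close>, \<open>t\<close> of the new coordinate the
induction hypothesis applies to the slices of \<open>f\<close>, \<open>g\<close>, \<open>h\<close> at \<open>s\<close>, \<open>t\<close>, \<open>s + t\<close>. It says that the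
integrals over these slices satisfy, up to a constant, the hypothesis of the one-dimensional inequality. This
stability under integration is the reason for working with functions instead of sets.\<close>

lemma prekopa_leindler_PiM:
  fixes f g h :: "('i \<Rightarrow> real) \<Rightarrow> ennreal"
  assumes "finite I"
    and "f \<in> borel_measurable (Pi\<^sub>M I (\<lambda>_. lborel))" "g \<in> borel_measurable (Pi\<^sub>M I (\<lambda>_. lborel))"
      "h \<in> borel_measurable (Pi\<^sub>M I (\<lambda>_. lborel))"
    and "\<And>x y. x \<in> extensional I \<Longrightarrow> y \<in> extensional I \<Longrightarrow> f x * g y \<le> (h (\<lambda>i\<in>I. x i + y i))\<^sup>2"
  shows "4 ^ card I * ((\<integral>\<^sup>+ x. f x \<partial>Pi\<^sub>M I (\<lambda>_. lborel)) * (\<integral>\<^sup>+ x. g x \<partial>Pi\<^sub>M I (\<lambda>_. lborel)))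
      \<le> (\<integral>\<^sup>+ x. h x \<partial>Pi\<^sub>M I (\<lambda>_. lborel))\<^sup>2"
  using assms
proof (induction I arbitrary: f g h rule: finite_induct)
  case empty
  then show ?case
    using empty(4)[of "\<lambda>_. undefined" "\<lambda>_. undefined"]
    by (simp add: PiM_empty nn_integral_count_space_finite restrict_def)
next
  case (insert i I)
  note [measurable] = insert.prems(1-3)
  let ?P = "Pi\<^sub>M I (\<lambda>_. lborel :: real measure)"
  let ?s = "\<lambda>k t. \<integral>\<^sup>+ x. k (x(i := t)) \<partial>?P"
  have sect: "?s k \<in> borel_measurable borel" "(\<lambda>x. k (x(i := t))) \<in> borel_measurable ?P"
    "integral\<^sup>N (Pi\<^sub>M (insert i I) (\<lambda>_. lborel)) k = (\<integral>\<^sup>+ t. ?s k t \<partial>lborel)"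
    if [measurable]: "k \<in> borel_measurable (Pi\<^sub>M (insert i I) (\<lambda>_. lborel))"
    for k :: "('i \<Rightarrow> real) \<Rightarrow> ennreal" and t
  proof -
    interpret sfP: sigma_finite_measure ?P
      using insert.hyps(1) by (rule lborel_product.sigma_finite)
    have "(\<lambda>(t,x). k (x(i := t))) \<in> borel_measurable (lborel \<Otimes>\<^sub>M ?P)" by measurable
    then show "?s k \<in> borel_measurable borel"
      using sfP.borel_measurable_nn_integral[of "\<lambda>t x. k (x(i := t))" lborel] by simp
    show "(\<lambda>x. k (x(i := t))) \<in> borel_measurable ?P" by measurable
    show "integral\<^sup>N (Pi\<^sub>M (insert i I) (\<lambda>_. lborel)) k = (\<integral>\<^sup>+ t. ?s k t \<partial>lborel)"
      using insert.hyps by (intro lborel_product.product_nn_integral_insert_rev) auto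
  qed
  \<comment> \<open>The constant \<open>4 ^ card I\<close> is distributed evenly over the two factors.\<close>
  let ?c = "2 ^ card I :: ennreal"
  have four: "(4::ennreal) ^ card I = ?c\<^sup>2"
    by (simp add: power_mult[symmetric] mult.commute[of _ 2]) (simp add: power_mult)
  have "4 * ((\<integral>\<^sup>+ s. ?c * ?s f s \<partial>lborel) * (\<integral>\<^sup>+ t. ?c * ?s g t \<partial>lborel))
      \<le> (\<integral>\<^sup>+ t. ?s h t \<partial>lborel)\<^sup>2"
  proof (rule prekopa_leindler_real)
    fix s t :: real
    have "4 ^ card I * (?s f s * ?s g t) \<le> (?s h (s + t))\<^sup>2"
    proof (rule insert.IH)
      fix x y :: "'i \<Rightarrow> real" assume xy: "x \<in> extensional I" "y \<in> extensional I"
      \<comment> \<open>Values outside the index set are undefined in extensional functions, so the slices recombine to an extensional function on \<open>insert i I\<close>.\<close>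
      have "f (x(i := s)) * g (y(i := t))
          \<le> (h (\<lambda>j\<in>insert i I. (x(i := s)) j + (y(i := t)) j))\<^sup>2"
        using xy by (intro insert.prems) (auto simp: extensional_def)
      also have "(\<lambda>j\<in>insert i I. (x(i := s)) j + (y(i := t)) j) = (\<lambda>j\<in>I. x j + y j)(i := s + t)"
        using insert.hyps by (auto simp: fun_eq_iff restrict_def)
      finally show "f (x(i := s)) * g (y(i := t)) \<le> (h ((\<lambda>j\<in>I. x j + y j)(i := s + t)))\<^sup>2" .
    qed (rule sect insert.prems)+
    then show "?c * ?s f s * (?c * ?s g t) \<le> (?s h (s + t))\<^sup>2"
      by (simp add: four power2_eq_square mult_ac)
  qed (use sect insert.prems in auto)
  then have "4 * ((?c * (\<integral>\<^sup>+ s. ?s f s \<partial>lborel)) * (?c * (\<integral>\<^sup>+ t. ?s g t \<partial>lborel)))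
      \<le> (\<integral>\<^sup>+ t. ?s h t \<partial>lborel)\<^sup>2"
    using sect insert.prems by (simp add: nn_integral_cmult)
  then show ?case
    using insert.hyps by (simp add: sect insert.prems four power2_eq_square mult_ac)
qed

lemma prekopa_leindler:
  fixes f g h :: "'a::euclidean_space \<Rightarrow> ennreal"
  assumes [measurable]: "f \<in> borel_measurable borel" "g \<in> borel_measurable borel"
      "h \<in> borel_measurable borel"
    and fgh: "\<And>x y. f x * g y \<le> (h (x + y))\<^sup>2"
  shows "4 ^ DIM('a) * ((\<integral>\<^sup>+ x. f x \<partial>lborel) * (\<integral>\<^sup>+ x. g x \<partial>lborel)) \<le> (\<integral>\<^sup>+ x. h x \<partial>lborel)\<^sup>2"
proof -
  let ?e = "\<lambda>v. \<Sum>b\<in>Basis. v b *\<^sub>R b :: 'a"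
  have [measurable]: "?e \<in> borel_measurable (Pi\<^sub>M Basis (\<lambda>_. lborel))" by measurable
  have eq: "integral\<^sup>N lborel k = (\<integral>\<^sup>+ v. k (?e v) \<partial>Pi\<^sub>M Basis (\<lambda>_. lborel))"
    if [measurable]: "k \<in> borel_measurable borel" for k :: "'a \<Rightarrow> ennreal"
    by (subst lborel_eq, subst nn_integral_distr) auto
  show ?thesis
    unfolding eq[OF assms(1)] eq[OF assms(2)] eq[OF assms(3)]
  proof (rule prekopa_leindler_PiM)
    fix v w :: "'a \<Rightarrow> real"
    show "f (?e v) * g (?e w) \<le> (h (?e (\<lambda>b\<in>Basis. v b + w b)))\<^sup>2"
      using fgh[of "?e v" "?e w"] by (simp add: sum.distrib scaleR_left_distrib)
  qed (auto)
qed

text \<open>The Prekopa-Leindler inequality is applied to the indicators of \<open>A\<close>, of its reflection \<open>- A\<close>,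
and of the ball about the origin whose radius is the diameter of \<open>A\<close>: a sum of a point of \<open>A\<close> and a
point of \<open>- A\<close> is a difference of points of \<open>A\<close>, so it belongs to that ball.\<close>

theorem isodiametric_inequality:
  fixes A :: "'a::euclidean_space set"
  assumes [measurable]: "A \<in> sets borel" and bdd: "bounded A"
  shows "emeasure lborel A \<le> ennreal (unit_ball_vol DIM('a) * (diameter A / 2) ^ DIM('a))"
proof -
  let ?n = "DIM('a)"
  have d0: "0 \<le> diameter A" using bdd by (rule diameter_ge_0)
  have [measurable]: "uminus -` A \<in> sets borel"
    using measurable_sets[of uminus borel borel A] by simp
  have "4 ^ ?n * ((\<integral>\<^sup>+ x. indicator A x \<partial>lborel) * (\<integral>\<^sup>+ x. indicator (uminus -` A) x \<partial>lborel))
      \<le> (\<integral>\<^sup>+ x. indicator (cball (0::'a) (diameter A)) x \<partial>lborel)\<^sup>2"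
  proof (rule prekopa_leindler[where f="indicator A" and g="indicator (uminus -` A)"
        and h="indicator (cball 0 (diameter A))"])
    fix x y :: 'a
    have "norm (x + y) \<le> diameter A" if "x \<in> A" "- y \<in> A"
      using diameter_bounded_bound[OF bdd that] by (simp add: dist_norm)
    then show "indicator A x * indicator (uminus -` A) y
        \<le> (indicator (cball 0 (diameter A)) (x + y) :: ennreal)\<^sup>2"
      by (auto simp: indicator_def)
  qed (auto intro!: borel_measurable_indicator)
  moreover have "emeasure lborel (uminus -` A) = emeasure lborel A"
  proof -
    have "emeasure lborel A = emeasure (distr lborel borel (\<lambda>x::'a. 0 + (-1) *\<^sub>R x)) A"
      by (subst lborel_affine[of "-1" 0]) (auto simp: density_1)
    also have "\<dots> = emeasure lborel (uminus -` A)"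
      by (subst emeasure_distr) (auto simp: vimage_def)
    finally show ?thesis by simp
  qed
  ultimately have le: "4 ^ ?n * (emeasure lborel A)\<^sup>2 \<le> (emeasure lborel (cball (0::'a) (diameter A)))\<^sup>2"
    by (simp add: power2_eq_square)
  have "emeasure lborel A \<noteq> top"
    using emeasure_bounded_finite[OF bdd] by simp
  then obtain v where v: "emeasure lborel A = ennreal v" "0 \<le> v"
    by (cases "emeasure lborel A") auto
  let ?w = "unit_ball_vol ?n * diameter A ^ ?n"
  have w0: "0 \<le> ?w" using d0 by (simp add: less_imp_le)
  have "ennreal ((2 ^ ?n * v)\<^sup>2) = 4 ^ ?n * (emeasure lborel A)\<^sup>2"
  proof -
    have "(2 ^ ?n * v)\<^sup>2 = 4 ^ ?n * v\<^sup>2"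
      by (simp add: power_mult_distrib power_mult[symmetric] mult.commute[of _ 2]) (simp add: power_mult)
    then show ?thesis using v
      by (simp add: ennreal_mult ennreal_power[symmetric])
  qed
  also have "\<dots> \<le> ennreal (?w\<^sup>2)"
    using le d0 w0 by (simp add: emeasure_cball ennreal_power)
  finally have "(2 ^ ?n * v)\<^sup>2 \<le> ?w\<^sup>2" by (simp add: ennreal_le_iff)
  then have "2 ^ ?n * v \<le> ?w" using w0 by (rule power2_le_imp_le)
  then have "v \<le> unit_ball_vol ?n * (diameter A / 2) ^ ?n"
    by (simp add: power_divide field_simps)
  then show ?thesis using v by (simp add: ennreal_leI)
qed

section \<open>Hausdorff measure on the Borel sets\<close>

lemma hausdorff_gauge_empty [simp]: "hausdorff_gauge k {} = 0"
  by (simp add: hausdorff_gauge_def)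

lemma hausdorff_premeasure_le:
  assumes "A \<subseteq> (\<Union>i. C i)" "\<And>i. bounded (C i)" "\<And>i. diameter (C i) \<le> \<delta>"
  shows "hausdorff_premeasure k \<delta> A \<le> (\<Sum>i::nat. hausdorff_gauge k (C i))"
  unfolding hausdorff_premeasure_def by (rule INF_lower) (use assms in auto)

lemma hausdorff_premeasure_empty:
  assumes "0 \<le> \<delta>" shows "hausdorff_premeasure k \<delta> {} = 0"
  using hausdorff_premeasure_le[of "{}" "\<lambda>_. {}" \<delta> k] assms by simp

lemma hausdorff_premeasure_mono:
  "A \<subseteq> B \<Longrightarrow> hausdorff_premeasure k \<delta> A \<le> hausdorff_premeasure k \<delta> B"
  unfolding hausdorff_premeasure_def by (rule INF_superset_mono) auto

lemma hausdorff_premeasure_antimono: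
  "\<delta> \<le> \<epsilon> \<Longrightarrow> hausdorff_premeasure k \<epsilon> A \<le> hausdorff_premeasure k \<delta> A"
  unfolding hausdorff_premeasure_def by (rule INF_superset_mono) (auto intro: order_trans)

lemma hausdorff_premeasure_approx:
  assumes "hausdorff_premeasure k \<delta> A < x"
  obtains C where "A \<subseteq> (\<Union>i::nat. C i)" "\<And>i. bounded (C i)" "\<And>i. diameter (C i) \<le> \<delta>"
    "(\<Sum>i. hausdorff_gauge k (C i)) < x"
  using assms unfolding hausdorff_premeasure_def INF_less_iff by blast

lemma hausdorff_premeasure_Union:
  fixes A :: "nat \<Rightarrow> 'a::metric_space set"
  shows "hausdorff_premeasure k \<delta> (\<Union>n. A n) \<le> (\<Sum>n. hausdorff_premeasure k \<delta> (A n))"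
proof (rule ennreal_le_epsilon)
  fix e :: real
  let ?H = "hausdorff_premeasure k \<delta>"
  assume fin: "(\<Sum>n. ?H (A n)) < top" and e: "0 < e"
  have "\<exists>C. A n \<subseteq> (\<Union>i::nat. C i) \<and> (\<forall>i. bounded (C i) \<and> diameter (C i) \<le> \<delta>) \<and>
      (\<Sum>i. hausdorff_gauge k (C i)) \<le> ?H (A n) + ennreal (e * (1/2) ^ Suc n)" for n
  proof -
    have "?H (A n) < top" using fin by (rule ennreal_suminf_lessD)
    then have "?H (A n) < ?H (A n) + ennreal (e * (1/2) ^ Suc n)"
      using e by (simp add: ennreal_add_left_cancel_less[of _ 0, simplified])
    then obtain C where "A n \<subseteq> (\<Union>i::nat. C i)" "\<And>i. bounded (C i)" "\<And>i. diameter (C i) \<le> \<delta>"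
        "(\<Sum>i. hausdorff_gauge k (C i)) < ?H (A n) + ennreal (e * (1/2) ^ Suc n)"
      by (rule hausdorff_premeasure_approx) blast
    then show ?thesis by (intro exI[of _ C]) (auto intro: less_imp_le)
  qed
  then obtain C where C: "\<And>n. A n \<subseteq> (\<Union>i::nat. C n i)" "\<And>n i. bounded (C n i)"
      "\<And>n i. diameter (C n i) \<le> \<delta>"
      "\<And>n. (\<Sum>i. hausdorff_gauge k (C n i)) \<le> ?H (A n) + ennreal (e * (1/2) ^ Suc n)"
    by metis
  define B where "B p = case_prod C (prod_decode p)" for p
  have "?H (\<Union>n. A n) \<le> (\<Sum>p. hausdorff_gauge k (B p))"
  proof (rule hausdorff_premeasure_le)
    show "(\<Union>n. A n) \<subseteq> (\<Union>p. B p)"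
    proof
      fix x assume "x \<in> (\<Union>n. A n)"
      then obtain n i where "x \<in> C n i" using C(1) by blast
      then have "x \<in> B (prod_encode (n, i))" by (simp add: B_def)
      then show "x \<in> (\<Union>p. B p)" by blast
    qed
  qed (auto simp: B_def C split: prod.split)
  also have "\<dots> = (\<Sum>n. \<Sum>i. hausdorff_gauge k (C n i))"
    unfolding B_def
    by (subst suminf_ennreal_2dimen[symmetric, where f="\<lambda>(n, i). hausdorff_gauge k (C n i)"])
       (auto intro!: suminf_cong split: prod.split)
  also have "\<dots> \<le> (\<Sum>n. ?H (A n) + ennreal (e * (1/2) ^ Suc n))"
    by (intro suminf_le C) auto
  also have "\<dots> = (\<Sum>n. ?H (A n)) + (\<Sum>n. ennreal (e * (1/2) ^ Suc n))"
    by (intro suminf_add[symmetric]) auto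
  also have "(\<Sum>n. ennreal (e * (1/2) ^ Suc n)) = ennreal e"
    using e sums_mult[OF power_half_series, of e] by (intro suminf_ennreal_eq) auto
  finally show "?H (\<Union>n. A n) \<le> (\<Sum>n. ?H (A n)) + ennreal e" .
qed

text \<open>A covering set of diameter at most \<open>\<delta>\<close> cannot meet both \<open>A\<close> and \<open>B\<close>, so every cover of the union
splits into a cover of \<open>A\<close> and a cover of \<open>B\<close>.\<close>

lemma hausdorff_premeasure_separated:
  fixes A B :: "'a::metric_space set"
  assumes sep: "\<And>x y. x \<in> A \<Longrightarrow> y \<in> B \<Longrightarrow> \<delta> < dist x y"
  shows "hausdorff_premeasure k \<delta> A + hausdorff_premeasure k \<delta> B \<le> hausdorff_premeasure k \<delta> (A \<union> B)"
  unfolding hausdorff_premeasure_def[of k \<delta> "A \<union> B"]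
proof (rule INF_greatest, safe)
  fix C :: "nat \<Rightarrow> 'a set"
  assume cov: "A \<union> B \<subseteq> (\<Union>i. C i)" and C: "\<forall>i. bounded (C i) \<and> diameter (C i) \<le> \<delta>"
  have one: "C i \<inter> A = {} \<or> C i \<inter> B = {}" for i
  proof (rule ccontr)
    assume "\<not> ?thesis"
    then obtain x y where xy: "x \<in> C i" "x \<in> A" "y \<in> C i" "y \<in> B" by blast
    then have "dist x y \<le> \<delta>"
      using C diameter_bounded_bound[of "C i" x y] order_trans by blast
    then show False using sep xy by force
  qed
  let ?A = "\<lambda>i. if C i \<inter> A = {} then {} else C i"
  let ?B = "\<lambda>i. if C i \<inter> B = {} then {} else C i"
  have "0 \<le> \<delta>" using C diameter_ge_0 order_trans by blast
  show "hausdorff_premeasure k \<delta> A + hausdorff_premeasure k \<delta> B \<le> (\<Sum>i. hausdorff_gauge k (C i))"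
  proof (cases "A = {} \<or> B = {}")
    case True
    have "hausdorff_premeasure k \<delta> (A \<union> B) \<le> (\<Sum>i. hausdorff_gauge k (C i))"
      using cov C by (intro hausdorff_premeasure_le) auto
    then show ?thesis using True \<open>0 \<le> \<delta>\<close> by (auto simp: hausdorff_premeasure_empty)
  next
    case False
    have "A \<subseteq> (\<Union>i. ?A i)" "B \<subseteq> (\<Union>i. ?B i)"
      using cov by fastforce+
    then have "hausdorff_premeasure k \<delta> A + hausdorff_premeasure k \<delta> B
      \<le> (\<Sum>i. hausdorff_gauge k (?A i)) + (\<Sum>i. hausdorff_gauge k (?B i))"
      using C \<open>0 \<le> \<delta>\<close> by (intro add_mono hausdorff_premeasure_le) auto
    also have "\<dots> = (\<Sum>i. hausdorff_gauge k (?A i) + hausdorff_gauge k (?B i))"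
      by (intro suminf_add) auto
    also have "\<dots> \<le> (\<Sum>i. hausdorff_gauge k (C i))"
      using one by (intro suminf_le) auto
    finally show ?thesis .
  qed
qed

lemma hausdorff_outer_empty [simp]: "hausdorff_outer k {} = 0"
  by (simp add: hausdorff_outer_def hausdorff_premeasure_empty)

lemma hausdorff_outer_mono: "A \<subseteq> B \<Longrightarrow> hausdorff_outer k A \<le> hausdorff_outer k B"
  unfolding hausdorff_outer_def by (intro SUP_mono) (auto intro: hausdorff_premeasure_mono)

lemma hausdorff_premeasure_le_outer: "0 < \<delta> \<Longrightarrow> hausdorff_premeasure k \<delta> A \<le> hausdorff_outer k A"
  unfolding hausdorff_outer_def by (rule SUP_upper) simp

lemma hausdorff_outer_Union: "hausdorff_outer k (\<Union>n::nat. A n) \<le> (\<Sum>n. hausdorff_outer k (A n))"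
  unfolding hausdorff_outer_def[of k "\<Union>n. A n"]
proof (rule SUP_least)
  fix \<delta> :: real assume "\<delta> \<in> {0<..}"
  then have "(\<Sum>n. hausdorff_premeasure k \<delta> (A n)) \<le> (\<Sum>n. hausdorff_outer k (A n))"
    by (intro suminf_le hausdorff_premeasure_le_outer) auto
  then show "hausdorff_premeasure k \<delta> (\<Union>n. A n) \<le> (\<Sum>n. hausdorff_outer k (A n))"
    using hausdorff_premeasure_Union order_trans by blast
qed

lemma hausdorff_outer_separated:
  fixes A B :: "'a::metric_space set"
  assumes "0 < d" and sep: "\<And>x y. x \<in> A \<Longrightarrow> y \<in> B \<Longrightarrow> d \<le> dist x y"
  shows "hausdorff_outer k A + hausdorff_outer k B \<le> hausdorff_outer k (A \<union> B)"
proof -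
  have dir: "\<exists>\<gamma>\<in>{0<..}. hausdorff_premeasure k \<delta> A + hausdorff_premeasure k \<epsilon> B
      \<le> hausdorff_premeasure k \<gamma> A + hausdorff_premeasure k \<gamma> B"
    if "\<delta> \<in> {0<..}" "\<epsilon> \<in> {0<..}" for \<delta> \<epsilon> :: real
    using that by (intro bexI[of _ "min \<delta> \<epsilon>"] add_mono hausdorff_premeasure_antimono) auto
  have "hausdorff_outer k A + hausdorff_outer k B
      = (SUP \<delta>\<in>{0<..}. hausdorff_premeasure k \<delta> A + hausdorff_premeasure k \<delta> B)"
    unfolding hausdorff_outer_def by (rule SUP_add_directed_ennreal[symmetric]) (rule dir)
  also have "\<dots> \<le> hausdorff_outer k (A \<union> B)"
  proof (rule SUP_least)
    fix \<delta> :: real assume \<delta>: "\<delta> \<in> {0<..}"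
    let ?m = "min \<delta> (d / 2)"
    have "hausdorff_premeasure k \<delta> A + hausdorff_premeasure k \<delta> B
        \<le> hausdorff_premeasure k ?m A + hausdorff_premeasure k ?m B"
      by (intro add_mono hausdorff_premeasure_antimono) auto
    also have "\<dots> \<le> hausdorff_premeasure k ?m (A \<union> B)"
      using sep \<open>0 < d\<close> by (intro hausdorff_premeasure_separated) force
    also have "\<dots> \<le> hausdorff_outer k (A \<union> B)"
      using \<delta> \<open>0 < d\<close> by (intro hausdorff_premeasure_le_outer) auto
    finally show "hausdorff_premeasure k \<delta> A + hausdorff_premeasure k \<delta> B \<le> hausdorff_outer k (A \<union> B)" .
  qed
  finally show ?thesis .
qed

text \<open>Caratheodory's criterion. The part \<open>P n\<close> of \<open>E\<close> at distance at least \<open>1 / (n + 1)\<close> from \<open>F\<close> is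
separated from \<open>E \<inter> F\<close>, so the inequality holds with \<open>P n\<close> in place of \<open>E - F\<close>. What is missing is
covered by the shells \<open>R n\<close>, \<open>R (n + 1)\<close>, and so on. Shells whose indices have the same parity are
separated from each other, so the measures of all shells add up to at most \<open>2 * \<mu> E\<close>; if this is finite,
the missing part tends to zero.\<close>

lemma metric_outer_measure_closed:
  fixes \<mu> :: "'a::metric_space set \<Rightarrow> ennreal"
  assumes empty: "\<mu> {} = 0"
    and mono: "\<And>A B. A \<subseteq> B \<Longrightarrow> \<mu> A \<le> \<mu> B"
    and Union: "\<And>A :: nat \<Rightarrow> 'a set. \<mu> (\<Union>n. A n) \<le> (\<Sum>n. \<mu> (A n))"
    and sep: "\<And>A B d. 0 < d \<Longrightarrow> (\<And>x y. x \<in> A \<Longrightarrow> y \<in> B \<Longrightarrow> d \<le> dist x y) \<Longrightarrow> \<mu> A + \<mu> B \<le> \<mu> (A \<union> B)"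
    and "closed F"
  shows "\<mu> (E \<inter> F) + \<mu> (E - F) \<le> \<mu> E"
proof (cases "F = {} \<or> \<mu> E = top")
  case True
  then show ?thesis using empty by (auto simp: top_unique)
next
  case False
  define D where "D = (\<lambda>x. infdist x F)"
  have Dlip: "D x - D y \<le> dist x y" for x y
    using infdist_triangle[of x F y] by (simp add: D_def)
  have D0: "D x = 0" if "x \<in> F" for x using that by (simp add: D_def)
  have Dpos: "0 < D x" if "x \<notin> F" for x
    using that False \<open>closed F\<close> in_closed_iff_infdist_zero[of F x] infdist_nonneg[of x F]
    by (auto simp: D_def less_le)
  define P where "P n = {x \<in> E. 1 / real (Suc n) \<le> D x}" for n
  define R where "R n = {x \<in> E. 1 / real (Suc (Suc n)) \<le> D x \<and> D x < 1 / real (Suc n)}" for n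
  have cover: "E - F \<subseteq> P n \<union> (\<Union>j. R (j + n))" for n
  proof
    fix x assume x: "x \<in> E - F"
    show "x \<in> P n \<union> (\<Union>j. R (j + n))"
    proof (cases "x \<in> P n")
      case False
      obtain m where m: "1 / real (Suc m) < D x"
        using Dpos[of x] x reals_Archimedean[of "D x"] by (auto simp: inverse_eq_divide)
      \<comment> \<open>Minimality of \<open>l\<close> bounds \<open>D x\<close> from above, which puts \<open>x\<close> into the shell with index \<open>l - 1\<close>.\<close>
      define l where "l = (LEAST l. 1 / real (Suc l) \<le> D x)"
      have l: "1 / real (Suc l) \<le> D x"
        unfolding l_def by (rule LeastI[of _ m]) (use m in simp)
      have "n < l"
      proof (rule ccontr)
        assume "\<not> n < l"
        then have "1 / real (Suc n) \<le> 1 / real (Suc l)" by (intro divide_left_mono) auto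
        then show False using l False x by (auto simp: P_def)
      qed
      then obtain j where j: "l = Suc (j + n)" by (metis add.commute less_imp_Suc_add)
      have "\<not> 1 / real (Suc (j + n)) \<le> D x"
        using not_less_Least[of "j + n" "\<lambda>l. 1 / real (Suc l) \<le> D x"] j by (simp add: l_def)
      then have "x \<in> R (j + n)" using l j x by (auto simp: R_def)
      then show ?thesis by blast
    qed blast
  qed
  have alternate: "(\<Sum>i<N. \<mu> (R (2 * i + c))) \<le> \<mu> (\<Union>i<N. R (2 * i + c))" for N c
  proof (induction N)
    case (Suc N)
    have "(\<Sum>i<Suc N. \<mu> (R (2 * i + c))) \<le> \<mu> (\<Union>i<N. R (2 * i + c)) + \<mu> (R (2 * N + c))"
      using Suc by (simp add: add_mono)
    also have "\<dots> \<le> \<mu> ((\<Union>i<N. R (2 * i + c)) \<union> R (2 * N + c))"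
    proof (cases "N = 0")
      case False
      show ?thesis
      proof (rule sep)
        show "0 < 1 / real (2 * N + c) - 1 / real (Suc (2 * N + c))"
          using False by (simp add: divide_strict_left_mono)
        fix x y assume x: "x \<in> (\<Union>i<N. R (2 * i + c))" and y: "y \<in> R (2 * N + c)"
        then obtain i where i: "i < N" "x \<in> R (2 * i + c)" by blast
        have "1 / real (2 * N + c) \<le> 1 / real (Suc (Suc (2 * i + c)))"
          using i(1) by (intro divide_left_mono) auto
        also have "\<dots> \<le> D x" using i(2) by (simp add: R_def)
        finally show "1 / real (2 * N + c) - 1 / real (Suc (2 * N + c)) \<le> dist x y"
          using Dlip[of x y] y by (simp add: R_def)
      qed
    qed (simp add: empty)
    also have "(\<Union>i<N. R (2 * i + c)) \<union> R (2 * N + c) = (\<Union>i<Suc N. R (2 * i + c))"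
      by (auto simp: less_Suc_eq)
    finally show ?case .
  qed (simp add: empty)
  have RE: "(\<Union>i\<in>X. R (g i)) \<subseteq> E" for X and g :: "nat \<Rightarrow> nat" by (auto simp: R_def)
  have partial: "(\<Sum>i<2 * N. \<mu> (R i)) \<le> \<mu> E + \<mu> E" for N
  proof -
    have "(\<Sum>i<2 * N. \<mu> (R i)) = (\<Sum>i<N. \<mu> (R (2 * i + 0))) + (\<Sum>i<N. \<mu> (R (2 * i + 1)))"
      by (induction N) (simp_all add: add_ac)
    also have "\<dots> \<le> \<mu> E + \<mu> E"
      by (intro add_mono order_trans[OF alternate] mono RE)
    finally show ?thesis .
  qed
  define T where "T = (\<Sum>n. \<mu> (R n))"
  have "T \<le> \<mu> E + \<mu> E"
    unfolding T_def
  proof (rule suminf_le_const)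
    fix n
    have "(\<Sum>i<n. \<mu> (R i)) \<le> (\<Sum>i<2 * n. \<mu> (R i))" by (intro sum_mono2) auto
    then show "(\<Sum>i<n. \<mu> (R i)) \<le> \<mu> E + \<mu> E" using partial order_trans by blast
  qed simp
  then have Tfin: "T \<noteq> top" using False by (auto simp: top_unique)
  have Un2: "\<mu> (A \<union> B) \<le> \<mu> A + \<mu> B" for A B
  proof -
    let ?C = "\<lambda>n::nat. if n = 0 then A else if n = 1 then B else {}"
    have "\<mu> (A \<union> B) \<le> \<mu> (\<Union>n. ?C n)" by (rule mono) (auto split: if_splits)
    also have "\<dots> \<le> (\<Sum>n. \<mu> (?C n))" by (rule Union)
    also have "\<dots> = (\<Sum>n<2. \<mu> (?C n))" using empty by (intro suminf_finite) auto
    finally show ?thesis by (simp add: numeral_2_eq_2)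
  qed
  let ?X = "\<mu> (E \<inter> F) + \<mu> (E - F)"
  \<comment> \<open>Adding the first \<open>n\<close> shells on both sides completes the remaining ones to the full sum \<open>T\<close>, which can be cancelled in the limit because it is finite.\<close>
  have step: "?X + (\<Sum>i<n. \<mu> (R i)) \<le> \<mu> E + T" for n
  proof -
    have "\<mu> (E - F) \<le> \<mu> (P n) + \<mu> (\<Union>j. R (j + n))"
      by (rule order_trans[OF mono[OF cover] Un2])
    also have "\<dots> \<le> \<mu> (P n) + (\<Sum>j. \<mu> (R (j + n)))" by (intro add_left_mono Union)
    finally have "?X + (\<Sum>i<n. \<mu> (R i)) \<le>
        (\<mu> (E \<inter> F) + \<mu> (P n)) + ((\<Sum>j. \<mu> (R (j + n))) + (\<Sum>i<n. \<mu> (R i)))"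
      by (simp add: add_mono add_ac)
    also have "(\<Sum>j. \<mu> (R (j + n))) + (\<Sum>i<n. \<mu> (R i)) = T"
      unfolding T_def by (rule suminf_offset[symmetric]) simp
    also have "\<mu> (E \<inter> F) + \<mu> (P n) \<le> \<mu> (E \<inter> F \<union> P n)"
    proof (rule sep)
      show "0 < 1 / real (Suc n)" by simp
      fix x y assume "x \<in> E \<inter> F" "y \<in> P n"
      then show "1 / real (Suc n) \<le> dist x y"
        using D0[of x] Dlip[of y x] by (auto simp: P_def dist_commute)
    qed
    also have "\<dots> \<le> \<mu> E" by (intro mono) (auto simp: P_def)
    finally show ?thesis by (simp add: add_right_mono)
  qed
  have "?X + T \<le> \<mu> E + T"
  proof (rule LIMSEQ_le_const2)
    show "(\<lambda>n. ?X + (\<Sum>i<n. \<mu> (R i))) \<longlonglongrightarrow> ?X + T"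
      unfolding T_def by (intro tendsto_add tendsto_const summable_LIMSEQ) simp
  qed (use step in blast)
  then show ?thesis using Tfin by (simp add: add.commute[of _ T] ennreal_add_left_cancel_le)
qed

lemma metric_outer_measure_borel:
  fixes \<mu> :: "'a::metric_space set \<Rightarrow> ennreal"
  assumes empty: "\<mu> {} = 0"
    and mono: "\<And>A B. A \<subseteq> B \<Longrightarrow> \<mu> A \<le> \<mu> B"
    and Union: "\<And>A :: nat \<Rightarrow> 'a set. \<mu> (\<Union>n. A n) \<le> (\<Sum>n. \<mu> (A n))"
    and sep: "\<And>A B d. 0 < d \<Longrightarrow> (\<And>x y. x \<in> A \<Longrightarrow> y \<in> B \<Longrightarrow> d \<le> dist x y) \<Longrightarrow> \<mu> A + \<mu> B \<le> \<mu> (A \<union> B)"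
  shows "measure_space UNIV (sets borel) \<mu>"
proof -
  interpret Pow: sigma_algebra "UNIV :: 'a set" "Pow UNIV" by (rule sigma_algebra_Pow)
  have oms: "outer_measure_space (Pow UNIV) \<mu>"
    unfolding outer_measure_space_def
    using empty mono Union by (auto simp: positive_def increasing_def countably_subadditive_def)
  let ?L = "lambda_system UNIV (Pow UNIV) \<mu>"
  have L: "measure_space UNIV ?L \<mu>" by (rule Pow.caratheodory_lemma[OF oms])
  then interpret L: sigma_algebra UNIV ?L by (simp add: measure_space_def)
  have "Collect closed \<subseteq> ?L"
  proof safe
    fix F :: "'a set" assume F: "closed F"
    have "\<mu> (E \<inter> F) + \<mu> (E - F) = \<mu> E" for E
    proof (rule antisym)
      show "\<mu> (E \<inter> F) + \<mu> (E - F) \<le> \<mu> E"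
        by (rule metric_outer_measure_closed[OF assms F])
      have "\<mu> ((E \<inter> F) \<union> (E - F)) \<le> \<mu> (E \<inter> F) + \<mu> (E - F)"
        using oms by (intro Pow.countably_subadditive_subadditive[unfolded subadditive_def, rule_format])
          (auto simp: outer_measure_space_def)
      also have "(E \<inter> F) \<union> (E - F) = E" by blast
      finally show "\<mu> E \<le> \<mu> (E \<inter> F) + \<mu> (E - F)" .
    qed
    then show "F \<in> ?L" by (subst Pow.lambda_system_eq) simp
  qed
  then have "sigma_sets UNIV (Collect closed) \<subseteq> ?L" by (rule L.sigma_sets_subset)
  then have "sets borel \<subseteq> ?L" by (simp add: borel_eq_closed)
  then show ?thesis
    using L sets.sigma_algebra_axioms[of "borel :: 'a measure"]
    by (auto simp: measure_space_def positive_def countably_additive_def)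
qed

lemma space_hausdorff_measure [simp]: "space (hausdorff_measure k) = UNIV"
  by (simp add: hausdorff_measure_def)

lemma sets_hausdorff_measure [simp, measurable_cong]: "sets (hausdorff_measure k) = sets borel"
  unfolding hausdorff_measure_def by (metis sets.sets_measure_of_eq space_borel)

lemma emeasure_hausdorff_measure:
  assumes "A \<in> sets borel"
  shows "emeasure (hausdorff_measure k) A = hausdorff_outer k A"
proof -
  have "measure_space UNIV (sets borel) (hausdorff_outer k :: 'a set \<Rightarrow> ennreal)"
    by (rule metric_outer_measure_borel)
      (auto intro: hausdorff_outer_mono hausdorff_outer_Union hausdorff_outer_separated)
  then show ?thesis
    unfolding hausdorff_measure_def measure_space_def
    using assms by (intro emeasure_measure_of_sigma) auto
qed

section \<open>Hausdorff measure in full dimension and on isometric copies\<close>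

lemma hausdorff_premeasure_le_countable:
  assumes "countable J" "0 \<le> \<delta>" "A \<subseteq> (\<Union>j\<in>J. C j)"
    and C: "\<And>j. j \<in> J \<Longrightarrow> bounded (C j)" "\<And>j. j \<in> J \<Longrightarrow> diameter (C j) \<le> \<delta>"
  shows "hausdorff_premeasure k \<delta> A \<le> (\<integral>\<^sup>+ j. hausdorff_gauge k (C j) \<partial>count_space J)"
proof -
  let ?N = "to_nat_on J ` J"
  define B where "B n = (if n \<in> ?N then C (from_nat_into J n) else {})" for n
  have B: "B (to_nat_on J j) = C j" if "j \<in> J" for j
    using that \<open>countable J\<close> by (simp add: B_def)
  have in_J: "from_nat_into J n \<in> J" if "n \<in> ?N" for n
    using that \<open>countable J\<close> by auto
  have "hausdorff_premeasure k \<delta> A \<le> (\<Sum>n. hausdorff_gauge k (B n))"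
  proof (rule hausdorff_premeasure_le)
    show "A \<subseteq> (\<Union>n. B n)" using assms(3) B by blast
  qed (use C in_J \<open>0 \<le> \<delta>\<close> in \<open>auto simp: B_def\<close>)
  also have "\<dots> = (\<integral>\<^sup>+ n. hausdorff_gauge k (B n) \<partial>count_space UNIV)"
    by (rule nn_integral_count_space_nat[symmetric])
  also have "\<dots> = (\<integral>\<^sup>+ n. hausdorff_gauge k (B n) \<partial>count_space ?N)"
    by (rule nn_integral_count_space_eq) (auto simp: B_def)
  also have "\<dots> = (\<integral>\<^sup>+ j. hausdorff_gauge k (B (to_nat_on J j)) \<partial>count_space J)"
    using \<open>countable J\<close>
    by (intro nn_integral_bij_count_space[symmetric]) (auto intro: inj_on_imp_bij_betw inj_on_to_nat_on)
  also have "\<dots> = (\<integral>\<^sup>+ j. hausdorff_gauge k (C j) \<partial>count_space J)"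
    by (intro nn_integral_cong) (simp add: B)
  finally show ?thesis .
qed

lemma hausdorff_gauge_cball:
  fixes x :: "'a::euclidean_space"
  assumes "0 \<le> r" "0 \<le> c"
  shows "hausdorff_gauge DIM('a) (cball x (c * r)) = ennreal (c ^ DIM('a)) * emeasure lborel (cball x r)"
proof -
  have "\<not> c * r < 0" "0 \<le> unit_ball_vol (real DIM('a)) * r ^ DIM('a)"
    using assms mult_nonneg_nonneg[OF assms(2,1)] by (auto simp: not_less)
  then show ?thesis
    using assms
    by (simp add: hausdorff_gauge_def emeasure_cball power_mult_distrib ennreal_mult[symmetric] mult_ac)
qed

lemma disjoint_cballs_emeasure_le:
  fixes a :: "'i \<Rightarrow> 'a::euclidean_space"
  assumes "countable J" "pairwise (\<lambda>i j. disjnt (cball (a i) (r i)) (cball (a j) (r j))) J"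
    and "\<And>j. j \<in> J \<Longrightarrow> cball (a j) (r j) \<subseteq> U" "U \<in> sets borel"
  shows "(\<integral>\<^sup>+ j. emeasure lborel (cball (a j) (r j)) \<partial>count_space J) \<le> emeasure lborel U"
proof -
  have "(\<integral>\<^sup>+ j. emeasure lborel (cball (a j) (r j)) \<partial>count_space J)
      = emeasure lborel (\<Union>j\<in>J. cball (a j) (r j))"
    using assms(1,2)
    by (intro emeasure_UN_countable[symmetric])
       (auto simp: disjoint_family_on_def pairwise_def disjnt_def)
  also have "\<dots> \<le> emeasure lborel U" using assms by (intro emeasure_mono) auto
  finally show ?thesis .
qed

text \<open>Inside an open set of small measure, the covering lemma of Vitali selects disjoint balls whose
fivefold enlargements still cover \<open>N\<close>. Enlarging multiplies the total cost only by a constant.\<close>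

lemma hausdorff_premeasure_negligible:
  fixes N :: "'a::euclidean_space set"
  assumes "negligible N" "0 < \<delta>"
  shows "hausdorff_premeasure DIM('a) \<delta> N = 0"
proof -
  let ?n = "DIM('a)"
  obtain N' where N': "N' \<in> null_sets lborel" "N \<subseteq> N'"
    using \<open>negligible N\<close> by (auto simp: negligible_iff_null_sets null_sets_completion_iff2)
  have "hausdorff_premeasure ?n \<delta> N \<le> 0"
  proof (rule ennreal_le_epsilon)
    fix e :: real assume e: "0 < e"
    \<comment> \<open>The factor \<open>5 ^ ?n\<close> compensates for the enlargement of the balls; radii up to \<open>\<delta> / 10\<close> keep the diameters of the enlarged balls below \<open>\<delta>\<close>.\<close>
    have "0 < e / 5 ^ ?n" using e by simp
    moreover have "N' \<in> sets borel" using null_setsD2[OF N'(1)] by simp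
    ultimately obtain U where U: "open U" "N' \<subseteq> U" "emeasure lborel (U - N') < ennreal (e / 5 ^ ?n)"
      using outer_regular_lborel[of N' "e / 5 ^ ?n"] by blast
    have Ule: "emeasure lborel U \<le> ennreal (e / 5 ^ ?n)"
      using U N'(1) emeasure_Diff_null_set[of N' lborel U] by (simp add: less_imp_le)
    have "\<exists>r. 0 < r \<and> r \<le> \<delta> / 10 \<and> cball x r \<subseteq> U" if "x \<in> N" for x
    proof -
      obtain s where "0 < s" "cball x s \<subseteq> U"
        using U N'(2) \<open>x \<in> N\<close> open_contains_cball by blast
      then show ?thesis using \<open>0 < \<delta>\<close>
        by (intro exI[of _ "min s (\<delta> / 10)"]) (auto simp: subset_iff)
    qed
    then obtain r where r: "\<And>x. x \<in> N \<Longrightarrow> 0 < r x \<and> r x \<le> \<delta> / 10"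
        and rU: "\<And>x. x \<in> N \<Longrightarrow> cball x (r x) \<subseteq> U"
      by metis
    have "N \<subseteq> (\<Union>x\<in>N. cball x (r x))" using r by (force simp: less_imp_le)
    then obtain J where J: "countable J" "J \<subseteq> N"
        "pairwise (\<lambda>x y. disjnt (cball x (r x)) (cball y (r y))) J"
        "N \<subseteq> (\<Union>x\<in>J. cball x (5 * r x))"
      using Vitali_covering_lemma_cballs[of N "\<lambda>x. x" r N "\<delta> / 10"] r by blast
    have J_r: "0 < r x" "r x \<le> \<delta> / 10" if "x \<in> J" for x using r J(2) that by blast+
    have "hausdorff_premeasure ?n \<delta> N \<le> (\<integral>\<^sup>+ x. hausdorff_gauge ?n (cball x (5 * r x)) \<partial>count_space J)"
      using J \<open>0 < \<delta>\<close> by (intro hausdorff_premeasure_le_countable) (auto dest: J_r)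
    also have "\<dots> = (\<integral>\<^sup>+ x. ennreal (5 ^ ?n) * emeasure lborel (cball x (r x)) \<partial>count_space J)"
      by (intro nn_integral_cong hausdorff_gauge_cball) (auto dest: J_r(1) simp: less_imp_le)
    also have "\<dots> = ennreal (5 ^ ?n) * (\<integral>\<^sup>+ x. emeasure lborel (cball x (r x)) \<partial>count_space J)"
      by (rule nn_integral_cmult) simp
    also have "\<dots> \<le> ennreal (5 ^ ?n) * emeasure lborel U"
      using J(1,3) U(1) subsetD[OF J(2), THEN rU]
      by (intro mult_left_mono disjoint_cballs_emeasure_le) auto
    also have "\<dots> \<le> ennreal (5 ^ ?n) * ennreal (e / 5 ^ ?n)" by (intro mult_left_mono Ule) simp
    also have "\<dots> = ennreal e" using e by (simp add: ennreal_mult[symmetric])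
    finally show "hausdorff_premeasure ?n \<delta> N \<le> 0 + ennreal e" by simp
  qed
  then show ?thesis by simp
qed

lemma hausdorff_premeasure_Un:
  assumes "0 \<le> \<delta>"
  shows "hausdorff_premeasure k \<delta> (A \<union> B) \<le> hausdorff_premeasure k \<delta> A + hausdorff_premeasure k \<delta> B"
proof -
  let ?C = "\<lambda>n::nat. if n = 0 then A else if n = 1 then B else {}"
  have "A \<union> B = (\<Union>n. ?C n)" by (auto split: if_splits)
  then have "hausdorff_premeasure k \<delta> (A \<union> B) \<le> (\<Sum>n. hausdorff_premeasure k \<delta> (?C n))"
    by (simp only: hausdorff_premeasure_Union)
  also have "\<dots> = (\<Sum>n<2. hausdorff_premeasure k \<delta> (?C n))"
    using assms by (intro suminf_finite) (auto simp: hausdorff_premeasure_empty)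
  finally show ?thesis by (simp add: numeral_2_eq_2)
qed

text \<open>For a ball the gauge is its volume. Vitali's theorem fills an open superset of \<open>B\<close> with small
disjoint balls up to a negligible set, which costs nothing.\<close>

lemma hausdorff_premeasure_le_lborel:
  fixes B :: "'a::euclidean_space set"
  assumes B: "B \<in> sets borel" and "0 < \<delta>"
  shows "hausdorff_premeasure DIM('a) \<delta> B \<le> emeasure lborel B"
proof (rule ennreal_le_epsilon)
  let ?n = "DIM('a)"
  fix e :: real assume "0 < e"
  then obtain U where U: "open U" "B \<subseteq> U" "emeasure lborel (U - B) < ennreal e"
    using outer_regular_lborel[OF B] by blast
  define K where "K = {(x, r). 0 < r \<and> r \<le> \<delta> / 2 \<and> cball x r \<subseteq> U}"
  have fine: "\<exists>i. i \<in> K \<and> x \<in> cball (fst i) (snd i) \<and> snd i < d" if "x \<in> U" "0 < d" for x d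
  proof -
    obtain s where "0 < s" "cball x s \<subseteq> U" using U(1) \<open>x \<in> U\<close> by (meson open_contains_cball)
    then show ?thesis using \<open>0 < \<delta>\<close> \<open>0 < d\<close>
      by (intro exI[of _ "(x, min s (min (d / 2) (\<delta> / 2)))"]) (auto simp: K_def subset_iff)
  qed
  obtain J where J: "countable J" "J \<subseteq> K"
      "pairwise (\<lambda>i j. disjnt (cball (fst i) (snd i)) (cball (fst j) (snd j))) J"
      "negligible (U - (\<Union>i\<in>J. cball (fst i) (snd i)))"
  proof (rule Vitali_covering_theorem_cballs[of K snd U fst])
    show "0 < snd i" if "i \<in> K" for i using that by (auto simp: K_def)
  qed (rule fine)
  let ?V = "\<Union>i\<in>J. cball (fst i) (snd i)"
  have K: "0 < snd i" "snd i \<le> \<delta> / 2" "cball (fst i) (snd i) \<subseteq> U" if "i \<in> J" for i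
    using subsetD[OF J(2) that] unfolding K_def by (simp_all add: case_prod_beta)
  have "hausdorff_premeasure ?n \<delta> B \<le> hausdorff_premeasure ?n \<delta> (?V \<union> (U - ?V))"
    using U(2) by (intro hausdorff_premeasure_mono) auto
  also have "\<dots> \<le> hausdorff_premeasure ?n \<delta> ?V + hausdorff_premeasure ?n \<delta> (U - ?V)"
    using \<open>0 < \<delta>\<close> by (intro hausdorff_premeasure_Un) simp
  also have "hausdorff_premeasure ?n \<delta> (U - ?V) = 0"
    using J(4) \<open>0 < \<delta>\<close> by (rule hausdorff_premeasure_negligible)
  also have "hausdorff_premeasure ?n \<delta> ?V
      \<le> (\<integral>\<^sup>+ i. hausdorff_gauge ?n (cball (fst i) (snd i)) \<partial>count_space J)"
    using J \<open>0 < \<delta>\<close> by (intro hausdorff_premeasure_le_countable) (auto dest: K)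
  also have "\<dots> = (\<integral>\<^sup>+ i. emeasure lborel (cball (fst i) (snd i)) \<partial>count_space J)"
  proof (intro nn_integral_cong)
    fix i assume "i \<in> space (count_space J)"
    then show "hausdorff_gauge ?n (cball (fst i) (snd i)) = emeasure lborel (cball (fst i) (snd i))"
      using hausdorff_gauge_cball[of "snd i" 1 "fst i"] K(1)[of i] by simp
  qed
  also have "\<dots> \<le> emeasure lborel U"
    using J U K by (intro disjoint_cballs_emeasure_le) auto
  also have "\<dots> = emeasure lborel B + emeasure lborel (U - B)"
    using U B by (subst plus_emeasure) (auto intro: arg_cong[where f="emeasure lborel"])
  also have "\<dots> \<le> emeasure lborel B + ennreal e"
    using U(3) by (intro add_left_mono less_imp_le)
  finally show "hausdorff_premeasure ?n \<delta> B \<le> emeasure lborel B + ennreal e"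
    by (simp add: add_mono)
qed

text \<open>By the isodiametric inequality each covering set costs at least the volume of its closure; the
closure makes the set measurable without changing its diameter.\<close>

lemma lborel_le_hausdorff_premeasure:
  fixes B :: "'a::euclidean_space set"
  assumes B: "B \<in> sets borel"
  shows "emeasure lborel B \<le> hausdorff_premeasure DIM('a) \<delta> B"
  unfolding hausdorff_premeasure_def
proof (rule INF_greatest, safe)
  fix C :: "nat \<Rightarrow> 'a set"
  assume cov: "B \<subseteq> (\<Union>i. C i)" and C: "\<forall>i. bounded (C i) \<and> diameter (C i) \<le> \<delta>"
  have "emeasure lborel B \<le> emeasure lborel (\<Union>i. closure (C i))"
    using cov closure_subset by (intro emeasure_mono) (blast, simp)
  also have "\<dots> \<le> (\<Sum>i. emeasure lborel (closure (C i)))"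
    by (rule emeasure_subadditive_countably) auto
  also have "\<dots> \<le> (\<Sum>i. hausdorff_gauge DIM('a) (C i))"
  proof (intro suminf_le)
    fix i
    show "emeasure lborel (closure (C i)) \<le> hausdorff_gauge DIM('a) (C i)"
      using isodiametric_inequality[of "closure (C i)"] C
      by (auto simp: hausdorff_gauge_def diameter_closure)
  qed auto
  finally show "emeasure lborel B \<le> (\<Sum>i. hausdorff_gauge DIM('a) (C i))" .
qed

theorem hausdorff_outer_eq_lborel:
  fixes B :: "'a::euclidean_space set"
  assumes B: "B \<in> sets borel"
  shows "hausdorff_outer DIM('a) B = emeasure lborel B"
proof (rule antisym)
  show "hausdorff_outer DIM('a) B \<le> emeasure lborel B"
    unfolding hausdorff_outer_def
    using hausdorff_premeasure_le_lborel[OF B] by (intro SUP_least) auto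
  show "emeasure lborel B \<le> hausdorff_outer DIM('a) B"
    using lborel_le_hausdorff_premeasure[OF B] hausdorff_premeasure_le_outer[of 1]
    by (rule order_trans) simp
qed

lemma diameter_isometric_image:
  assumes iso: "\<And>x y. dist (\<phi> x) (\<phi> y) = dist x y"
  shows "diameter (\<phi> ` S) = diameter S"
proof -
  have "\<phi> ` S \<times> \<phi> ` S = map_prod \<phi> \<phi> ` (S \<times> S)" by auto
  then show ?thesis
    by (simp add: diameter_def image_image case_prod_unfold iso)
qed

lemma hausdorff_outer_isometric_image:
  fixes \<phi> :: "'a::metric_space \<Rightarrow> 'b::metric_space"
  assumes iso: "\<And>x y. dist (\<phi> x) (\<phi> y) = dist x y"
  shows "hausdorff_outer k (\<phi> ` A) = hausdorff_outer k A"
proof -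
  have bdd: "bounded (\<phi> ` S) \<longleftrightarrow> bounded S" for S
  proof (cases "S = {}")
    case False
    then obtain x where "x \<in> S" by blast
    show ?thesis by (simp add: bounded_any_center[of S x] bounded_any_center[of "\<phi> ` S" "\<phi> x"] iso)
  qed simp
  have gauge: "hausdorff_gauge k (\<phi> ` S) = hausdorff_gauge k S" for S
    by (simp add: hausdorff_gauge_def diameter_isometric_image[OF iso])
  have "hausdorff_premeasure k \<delta> (\<phi> ` A) = hausdorff_premeasure k \<delta> A" for \<delta>
  proof (rule antisym)
    show "hausdorff_premeasure k \<delta> (\<phi> ` A) \<le> hausdorff_premeasure k \<delta> A"
      unfolding hausdorff_premeasure_def[of k \<delta> A]
    proof (rule INF_greatest, safe)
      fix C :: "nat \<Rightarrow> 'a set"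
      assume "A \<subseteq> (\<Union>i. C i)" "\<forall>i. bounded (C i) \<and> diameter (C i) \<le> \<delta>"
      moreover from this have "\<phi> ` A \<subseteq> (\<Union>i. \<phi> ` C i)" by blast
      ultimately have "hausdorff_premeasure k \<delta> (\<phi> ` A) \<le> (\<Sum>i. hausdorff_gauge k (\<phi> ` C i))"
        by (intro hausdorff_premeasure_le) (auto simp: bdd diameter_isometric_image[OF iso])
      then show "hausdorff_premeasure k \<delta> (\<phi> ` A) \<le> (\<Sum>i. hausdorff_gauge k (C i))"
        by (simp add: gauge)
    qed
    show "hausdorff_premeasure k \<delta> A \<le> hausdorff_premeasure k \<delta> (\<phi> ` A)"
      unfolding hausdorff_premeasure_def[of k \<delta> "\<phi> ` A"]
    proof (rule INF_greatest, safe)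
      fix C :: "nat \<Rightarrow> 'b set"
      assume cov: "\<phi> ` A \<subseteq> (\<Union>i. C i)" and C: "\<forall>i. bounded (C i) \<and> diameter (C i) \<le> \<delta>"
      have sub: "\<phi> ` (\<phi> -` C i) \<subseteq> C i" for i by blast
      have b: "bounded (\<phi> -` C i)" for i
        using C sub bounded_subset bdd by metis
      have d: "diameter (\<phi> -` C i) \<le> diameter (C i)" for i
        using diameter_subset[OF sub[of i]] C unfolding diameter_isometric_image[OF iso] by blast
      have "hausdorff_premeasure k \<delta> A \<le> (\<Sum>i. hausdorff_gauge k (\<phi> -` C i))"
      proof (rule hausdorff_premeasure_le)
        show "A \<subseteq> (\<Union>i. \<phi> -` C i)" using cov by blast
        show "diameter (\<phi> -` C i) \<le> \<delta>" for i using C d order_trans by blast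
      qed (rule b)
      also have "\<dots> \<le> (\<Sum>i. hausdorff_gauge k (C i))"
      proof (intro suminf_le)
        fix i
        have "(diameter (\<phi> -` C i) / 2) ^ k \<le> (diameter (C i) / 2) ^ k"
          using d[of i] diameter_ge_0[OF b] by (intro power_mono) auto
        then show "hausdorff_gauge k (\<phi> -` C i) \<le> hausdorff_gauge k (C i)"
          by (auto simp: hausdorff_gauge_def intro!: ennreal_leI mult_left_mono)
      qed auto
      finally show "hausdorff_premeasure k \<delta> A \<le> (\<Sum>i. hausdorff_gauge k (C i))" .
    qed
  qed
  then show ?thesis by (simp add: hausdorff_outer_def)
qed

text \<open>The Hausdorff measure restricted to the range of an isometry and the image of Lebesgue measure
agree on Borel sets, by isometry invariance and the equality of the two measures on the Euclidean domain.\<close>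

theorem nn_integral_hausdorff_isometric_range:
  fixes \<phi> :: "'a::euclidean_space \<Rightarrow> 'b::metric_space"
  assumes iso: "\<And>x y. dist (\<phi> x) (\<phi> y) = dist x y"
    and range [measurable]: "range \<phi> \<in> sets borel"
    and g [measurable]: "g \<in> borel_measurable borel"
  shows "(\<integral>\<^sup>+ x\<in>range \<phi>. g x \<partial>hausdorff_measure DIM('a)) = (\<integral>\<^sup>+ y. g (\<phi> y) \<partial>lborel)"
proof -
  have "continuous_on UNIV \<phi>"
    unfolding continuous_on_iff iso by blast
  then have [measurable]: "\<phi> \<in> borel_measurable borel" by (rule borel_measurable_continuous_onI)
  let ?H = "hausdorff_measure DIM('a) :: 'b measure"
  have eq: "density ?H (indicator (range \<phi>)) = distr lborel borel \<phi>"
  proof (rule measure_eqI)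
    fix A assume "A \<in> sets (density ?H (indicator (range \<phi>)))"
    then have A [measurable]: "A \<in> sets borel" by simp
    have vA: "\<phi> -` A \<in> sets borel" using measurable_sets[of \<phi> borel borel A] by simp
    have "emeasure (density ?H (indicator (range \<phi>))) A = emeasure ?H (range \<phi> \<inter> A)"
      by (subst emeasure_density) (auto simp: indicator_inter_arith[symmetric] nn_integral_indicator)
    also have "\<dots> = hausdorff_outer DIM('a) (range \<phi> \<inter> A)"
      by (rule emeasure_hausdorff_measure) simp
    also have "range \<phi> \<inter> A = \<phi> ` (\<phi> -` A)" by blast
    also have "hausdorff_outer DIM('a) (\<phi> ` (\<phi> -` A)) = hausdorff_outer DIM('a) (\<phi> -` A)"
      by (rule hausdorff_outer_isometric_image[OF iso])
    also have "\<dots> = emeasure lborel (\<phi> -` A)"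
      using vA by (rule hausdorff_outer_eq_lborel)
    also have "\<dots> = emeasure (distr lborel borel \<phi>) A"
      by (subst emeasure_distr) auto
    finally show "emeasure (density ?H (indicator (range \<phi>))) A = emeasure (distr lborel borel \<phi>) A" .
  qed simp
  have "(\<integral>\<^sup>+ x\<in>range \<phi>. g x \<partial>?H) = integral\<^sup>N (density ?H (indicator (range \<phi>))) g"
    by (subst nn_integral_density) (auto simp: mult.commute)
  also have "\<dots> = (\<integral>\<^sup>+ y. g (\<phi> y) \<partial>lborel)"
    unfolding eq by (subst nn_integral_distr) auto
  finally show ?thesis .
qed

section \<open>Integration over a hyperplane\<close>

text \<open>An index type with one element less than \<open>'n\<close>. A hyperplane in the space of vectors indexed by \<open>'n\<close> is
an isometric copy of the Euclidean space of vectors indexed by this type. One element is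
removed, except when it is the only one, because a type cannot be empty.\<close>

typedef ('n::finite) smaller = "{x :: 'n. x \<noteq> (SOME y. True) \<or> UNIV = {x}}"
  by blast

instance smaller :: (finite) finite
proof
  have "finite (Abs_smaller ` {x :: 'a. x \<noteq> (SOME y. True) \<or> UNIV = {x}})" by simp
  then show "finite (UNIV :: 'a smaller set)"
    by (simp only: type_definition.Abs_image[OF type_definition_smaller])
qed

lemma CARD_smaller:
  assumes "2 \<le> CARD('n::finite)"
  shows "CARD('n smaller) = CARD('n) - 1"
proof -
  have "UNIV \<noteq> {x}" for x :: 'n
  proof
    assume "UNIV = {x}"
    then have "CARD('n) = card {x}" by simp
    then show False using assms by simp
  qed
  then have "{x :: 'n. x \<noteq> (SOME y. True) \<or> UNIV = {x}} = UNIV - {SOME y. True}" by auto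
  then have "CARD('n smaller) = card (UNIV - {SOME y :: 'n. True})"
    by (simp only: type_definition.card[OF type_definition_smaller])
  then show ?thesis by (simp add: card_Diff_singleton)
qed

lemma orthonormal_sum_inner:
  fixes u :: "'i \<Rightarrow> 'b::real_inner"
  assumes "finite A" and orth: "\<And>i j. i \<in> A \<Longrightarrow> j \<in> A \<Longrightarrow> u i \<bullet> u j = (if i = j then 1 else 0)"
  shows "(\<Sum>i\<in>A. c i *\<^sub>R u i) \<bullet> (\<Sum>i\<in>A. d i *\<^sub>R u i) = (\<Sum>i\<in>A. c i * d i)"
proof -
  have "(\<Sum>i\<in>A. c i *\<^sub>R u i) \<bullet> (\<Sum>i\<in>A. d i *\<^sub>R u i) = (\<Sum>i\<in>A. \<Sum>j\<in>A. c i * (d j * (u i \<bullet> u j)))"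
    unfolding inner_sum_left by (simp add: inner_sum_right sum_distrib_left mult.left_commute)
  also have "\<dots> = (\<Sum>i\<in>A. \<Sum>j\<in>A. if j = i then c i * d i else 0)"
    by (intro sum.cong refl) (auto simp: orth)
  also have "\<dots> = (\<Sum>i\<in>A. c i * d i)"
    using \<open>finite A\<close> by simp
  finally show ?thesis .
qed

lemma sum_enumerated_Basis_inner:
  fixes e :: "'i \<Rightarrow> 'a::euclidean_space"
  assumes e: "bij_betw e K Basis" and "j \<in> K"
  shows "(\<Sum>i\<in>K. c i *\<^sub>R e i) \<bullet> e j = c j"
proof -
  have "finite K" using bij_betw_finite[OF e] by simp
  have "e i \<bullet> e j = (if i = j then 1 else 0)" if "i \<in> K" for i
  proof -
    have "e i \<in> Basis" "e j \<in> Basis" "e i = e j \<longleftrightarrow> i = j"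
      using e that \<open>j \<in> K\<close> by (auto simp: bij_betw_def inj_on_def)
    then show ?thesis by (simp add: inner_Basis)
  qed
  then have "(\<Sum>i\<in>K. c i *\<^sub>R e i) \<bullet> e j = (\<Sum>i\<in>K. if i = j then c i else 0)"
    unfolding inner_sum_left by (intro sum.cong refl) auto
  then show ?thesis using \<open>finite K\<close> \<open>j \<in> K\<close> by simp
qed

text \<open>Lebesgue measure in coordinates that are numbered by an arbitrary index set \<open>K\<close> and not by the
basis vectors themselves.\<close>

lemma lborel_eq_distr_PiM:
  fixes e :: "'i \<Rightarrow> 'a::euclidean_space"
  assumes e: "bij_betw e K Basis"
  shows "(lborel :: 'a measure) = distr (Pi\<^sub>M K (\<lambda>_. lborel)) borel (\<lambda>\<nu>. \<Sum>i\<in>K. \<nu> i *\<^sub>R e i)"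
proof (rule lborel_eqI)
  have finK [simp]: "finite K" using bij_betw_finite[OF e] by simp
  have eB: "e i \<in> Basis" if "i \<in> K" for i using e that by (auto simp: bij_betw_def)
  let ?\<psi> = "\<lambda>\<nu>. \<Sum>i\<in>K. \<nu> i *\<^sub>R e i"
  have [measurable]: "?\<psi> \<in> borel_measurable (Pi\<^sub>M K (\<lambda>_. lborel))" by measurable
  fix l r :: 'a
  assume lr: "\<And>b. b \<in> Basis \<Longrightarrow> l \<bullet> b \<le> r \<bullet> b"
  have box: "?\<psi> \<nu> \<in> box l r \<longleftrightarrow> (\<forall>i\<in>K. l \<bullet> e i < \<nu> i \<and> \<nu> i < r \<bullet> e i)" for \<nu>
  proof -
    have "?\<psi> \<nu> \<in> box l r \<longleftrightarrow> (\<forall>b\<in>e ` K. l \<bullet> b < ?\<psi> \<nu> \<bullet> b \<and> ?\<psi> \<nu> \<bullet> b < r \<bullet> b)"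
      using e by (simp add: bij_betw_def mem_box)
    also have "\<dots> \<longleftrightarrow> (\<forall>i\<in>K. l \<bullet> e i < ?\<psi> \<nu> \<bullet> e i \<and> ?\<psi> \<nu> \<bullet> e i < r \<bullet> e i)"
      by blast
    finally show ?thesis by (simp add: sum_enumerated_Basis_inner[OF e])
  qed
  have "emeasure (distr (Pi\<^sub>M K (\<lambda>_. lborel)) borel ?\<psi>) (box l r)
      = emeasure (Pi\<^sub>M K (\<lambda>_. lborel)) (?\<psi> -` box l r \<inter> space (Pi\<^sub>M K (\<lambda>_. lborel)))"
    by (subst emeasure_distr) auto
  also have "?\<psi> -` box l r \<inter> space (Pi\<^sub>M K (\<lambda>_. lborel)) = Pi\<^sub>E K (\<lambda>i. {l \<bullet> e i<..<r \<bullet> e i})"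
    unfolding space_PiM by (auto simp: PiE_iff) (simp_all add: box[THEN iffD1] box[THEN iffD2])
  also have "emeasure (Pi\<^sub>M K (\<lambda>_. lborel)) \<dots> = (\<Prod>i\<in>K. emeasure lborel {l \<bullet> e i<..<r \<bullet> e i})"
    by (intro lborel_product.emeasure_PiM) auto
  also have "\<dots> = (\<Prod>i\<in>K. ennreal ((r - l) \<bullet> e i))"
    using lr eB by (intro prod.cong refl) (simp add: inner_diff_left)
  also have "\<dots> = ennreal (\<Prod>i\<in>K. (r - l) \<bullet> e i)"
    using lr eB by (intro prod_ennreal) (simp add: inner_diff_left)
  also have "(\<Prod>i\<in>K. (r - l) \<bullet> e i) = (\<Prod>b\<in>Basis. (r - l) \<bullet> b)"
    by (rule prod.reindex_bij_betw[OF e])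
  finally show "emeasure (distr (Pi\<^sub>M K (\<lambda>_. lborel)) borel ?\<psi>) (box l r) = ennreal (\<Prod>b\<in>Basis. (r - l) \<bullet> b)" .
qed simp

text \<open>The orthonormal family spans a subspace of the hyperplane orthogonal to \<open>a\<close>, of the same
dimension.\<close>

lemma orthonormal_hyperplane_span:
  fixes a :: "'b::euclidean_space" and u :: "'i \<Rightarrow> 'b"
  assumes "a \<noteq> 0" "finite K" "card K = DIM('b) - 1"
    and orth: "\<And>i j. i \<in> K \<Longrightarrow> j \<in> K \<Longrightarrow> u i \<bullet> u j = (if i = j then 1 else 0)"
    and perp: "\<And>i. i \<in> K \<Longrightarrow> a \<bullet> u i = 0"
    and z: "a \<bullet> z = 0"
  obtains c where "z = (\<Sum>i\<in>K. c i *\<^sub>R u i)"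
proof -
  have inj: "inj_on u K"
  proof (rule inj_onI)
    fix i j assume "i \<in> K" "j \<in> K" "u i = u j"
    then show "i = j" using orth[of i i] orth[of i j] by (auto split: if_splits)
  qed
  have "pairwise orthogonal (u ` K)"
    using orth by (auto simp: pairwise_def orthogonal_def)
  moreover have "0 \<notin> u ` K" using orth by force
  ultimately have ind: "independent (u ` K)" by (rule pairwise_orthogonal_independent)
  have "span (u ` K) = {x. a \<bullet> x = 0}"
  proof (rule subspace_dim_equal)
    show "span (u ` K) \<subseteq> {x. a \<bullet> x = 0}"
      using perp by (intro span_minimal subspace_hyperplane) auto
    show "dim {x. a \<bullet> x = 0} \<le> dim (span (u ` K))"
      using \<open>a \<noteq> 0\<close> ind inj assms(3) by (simp add: dim_hyperplane dim_eq_card_independent card_image)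
  qed (auto intro: subspace_hyperplane)
  then have "z \<in> span (u ` K)" using z by simp
  then obtain d where "z = (\<Sum>v\<in>u ` K. d v *\<^sub>R v)"
    using \<open>finite K\<close> by (auto simp: span_finite)
  then have "z = (\<Sum>i\<in>K. d (u i) *\<^sub>R u i)" using inj by (simp add: sum.reindex)
  then show thesis by (rule that)
qed

theorem nn_integral_hausdorff_hyperplane:
  fixes a w :: "real ^ 'n" and u :: "'i \<Rightarrow> real ^ 'n"
  assumes "2 \<le> CARD('n)" "a \<noteq> 0" "a \<bullet> w = b" "finite K" "card K = CARD('n) - 1"
    and orth: "\<And>i j. i \<in> K \<Longrightarrow> j \<in> K \<Longrightarrow> u i \<bullet> u j = (if i = j then 1 else 0)"
    and perp: "\<And>i. i \<in> K \<Longrightarrow> a \<bullet> u i = 0"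
    and g [measurable]: "g \<in> borel_measurable borel"
  shows "(\<integral>\<^sup>+ x\<in>{x. a \<bullet> x = b}. g x \<partial>hausdorff_measure (CARD('n) - 1))
      = (\<integral>\<^sup>+ \<nu>. g (w + (\<Sum>i\<in>K. \<nu> i *\<^sub>R u i)) \<partial>Pi\<^sub>M K (\<lambda>_. lborel))"
proof -
  have card: "card K = card (Basis :: (real ^ 'n smaller) set)"
    using assms(1,5) by (simp add: CARD_smaller)
  obtain e :: "'i \<Rightarrow> real ^ 'n smaller" where e: "bij_betw e K Basis"
    using finite_same_card_bij[OF \<open>finite K\<close> _ card] by auto
  define \<phi> where "\<phi> y = w + (\<Sum>i\<in>K. (y \<bullet> e i) *\<^sub>R u i)" for y
  have \<phi>_sum: "\<phi> (\<Sum>i\<in>K. c i *\<^sub>R e i) = w + (\<Sum>i\<in>K. c i *\<^sub>R u i)" for c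
    by (simp add: \<phi>_def sum_enumerated_Basis_inner[OF e])
  have iso: "dist (\<phi> x) (\<phi> y) = dist x y" for x y
  proof -
    have "\<phi> x - \<phi> y = (\<Sum>i\<in>K. ((x - y) \<bullet> e i) *\<^sub>R u i)"
      by (simp add: \<phi>_def inner_diff_left scaleR_diff_left sum_subtractf)
    then have "(norm (\<phi> x - \<phi> y))\<^sup>2 = (\<Sum>i\<in>K. ((x - y) \<bullet> e i) * ((x - y) \<bullet> e i))"
      using \<open>finite K\<close> orth by (simp add: power2_norm_eq_inner orthonormal_sum_inner)
    also have "\<dots> = (\<Sum>b\<in>Basis. ((x - y) \<bullet> b) * ((x - y) \<bullet> b))"
      by (rule sum.reindex_bij_betw[OF e])
    also have "\<dots> = (norm (x - y))\<^sup>2"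
      unfolding power2_norm_eq_inner by (rule euclidean_inner[symmetric])
    finally show ?thesis by (simp add: dist_norm)
  qed
  \<comment> \<open>The range is the whole hyperplane because the vectors \<open>u i\<close> are as many as its dimension.\<close>
  have range: "range \<phi> = {x. a \<bullet> x = b}"
  proof (intro equalityI subsetI)
    fix x assume "x \<in> range \<phi>"
    then show "x \<in> {x. a \<bullet> x = b}"
      using \<open>a \<bullet> w = b\<close> perp by (auto simp: \<phi>_def inner_add_right inner_sum_right)
  next
    fix x assume "x \<in> {x. a \<bullet> x = b}"
    then have "a \<bullet> (x - w) = 0" using \<open>a \<bullet> w = b\<close> by (simp add: inner_diff_right)
    then obtain c where "x - w = (\<Sum>i\<in>K. c i *\<^sub>R u i)"
      using orthonormal_hyperplane_span[OF \<open>a \<noteq> 0\<close> \<open>finite K\<close> _ orth perp] assms(5) by auto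
    then have "x = \<phi> (\<Sum>i\<in>K. c i *\<^sub>R e i)" unfolding \<phi>_sum by (simp add: algebra_simps)
    then show "x \<in> range \<phi>" by blast
  qed
  have "continuous_on UNIV \<phi>" unfolding \<phi>_def by (intro continuous_intros)
  then have [measurable]: "\<phi> \<in> borel_measurable borel" by (rule borel_measurable_continuous_onI)
  have "closed {x. a \<bullet> x = b}" by (rule closed_hyperplane)
  then have "range \<phi> \<in> sets borel" by (simp add: range)
  then have "(\<integral>\<^sup>+ x\<in>range \<phi>. g x \<partial>hausdorff_measure DIM(real ^ 'n smaller)) = (\<integral>\<^sup>+ y. g (\<phi> y) \<partial>lborel)"
    using iso by (intro nn_integral_hausdorff_isometric_range) auto
  also have "\<dots> = (\<integral>\<^sup>+ \<nu>. g (\<phi> (\<Sum>i\<in>K. \<nu> i *\<^sub>R e i)) \<partial>Pi\<^sub>M K (\<lambda>_. lborel))"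
    by (subst lborel_eq_distr_PiM[OF e], subst nn_integral_distr) auto
  finally show ?thesis
    using assms(1) by (simp add: range \<phi>_sum CARD_smaller)
qed

lemma nn_integral_PiM_rescale:
  fixes F :: "('i \<Rightarrow> real) \<Rightarrow> ennreal"
  assumes "finite K" "k \<in> K" "0 < c" and F [measurable]: "F \<in> borel_measurable (Pi\<^sub>M K (\<lambda>_. lborel))"
  shows "(\<integral>\<^sup>+ \<nu>. F \<nu> \<partial>Pi\<^sub>M K (\<lambda>_. lborel)) = ennreal c * (\<integral>\<^sup>+ \<mu>. F (\<mu>(k := c * \<mu> k)) \<partial>Pi\<^sub>M K (\<lambda>_. lborel))"
proof -
  let ?L = "K - {k}"
  have K: "K = insert k ?L" using \<open>k \<in> K\<close> by blast
  let ?F = "\<lambda>\<mu>. F (\<mu>(k := c * \<mu> k))"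
  have shift: "(\<lambda>\<mu>. \<mu>(k := c * \<mu> k)) \<in> Pi\<^sub>M K (\<lambda>_. lborel) \<rightarrow>\<^sub>M Pi\<^sub>M K (\<lambda>_. lborel :: real measure)"
    using \<open>k \<in> K\<close> by (intro measurable_fun_upd[where J=K]) auto
  have F' [measurable]: "?F \<in> borel_measurable (Pi\<^sub>M K (\<lambda>_. lborel))"
    using measurable_compose[OF shift F] .
  have split: "integral\<^sup>N (Pi\<^sub>M K (\<lambda>_. lborel)) H
      = (\<integral>\<^sup>+ x. \<integral>\<^sup>+ y. H (x(k := y)) \<partial>lborel \<partial>Pi\<^sub>M ?L (\<lambda>_. lborel))"
    if "H \<in> borel_measurable (Pi\<^sub>M K (\<lambda>_. lborel))" for H :: "('i \<Rightarrow> real) \<Rightarrow> ennreal"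
    using that lborel_product.product_nn_integral_insert[of ?L k H] K \<open>finite K\<close> by simp
  have sect: "(\<lambda>y. H (x(k := y))) \<in> borel_measurable borel"
    if "H \<in> borel_measurable (Pi\<^sub>M K (\<lambda>_. lborel))" "x \<in> space (Pi\<^sub>M ?L (\<lambda>_. lborel))"
    for H :: "('i \<Rightarrow> real) \<Rightarrow> ennreal" and x
  proof -
    have "(\<lambda>y. x(k := y)) \<in> lborel \<rightarrow>\<^sub>M Pi\<^sub>M K (\<lambda>_. lborel)"
      using that(2) K by (intro measurable_fun_upd[where J="?L"]) auto
    from measurable_compose[OF this that(1)] show ?thesis by simp
  qed
  have meas: "(\<lambda>x. \<integral>\<^sup>+ y. ?F (x(k := y)) \<partial>lborel) \<in> borel_measurable (Pi\<^sub>M ?L (\<lambda>_. lborel))"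
  proof -
    have "(\<lambda>(x, y). ?F (x(k := y))) \<in> borel_measurable (Pi\<^sub>M ?L (\<lambda>_. lborel) \<Otimes>\<^sub>M lborel)"
    proof -
      have "(\<lambda>z. (fst z)(k := snd z)) \<in> Pi\<^sub>M ?L (\<lambda>_. lborel) \<Otimes>\<^sub>M lborel \<rightarrow>\<^sub>M Pi\<^sub>M K (\<lambda>_. lborel :: real measure)"
        using K by (intro measurable_fun_upd[where J="?L"]) auto
      from measurable_compose[OF this F'] show ?thesis by (simp add: case_prod_beta)
    qed
    then show ?thesis by (rule lborel.borel_measurable_nn_integral)
  qed
  have "(\<integral>\<^sup>+ \<nu>. F \<nu> \<partial>Pi\<^sub>M K (\<lambda>_. lborel))
      = (\<integral>\<^sup>+ x. \<integral>\<^sup>+ y. F (x(k := y)) \<partial>lborel \<partial>Pi\<^sub>M ?L (\<lambda>_. lborel))"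
    using F by (rule split)
  also have "\<dots> = (\<integral>\<^sup>+ x. ennreal c * (\<integral>\<^sup>+ y. ?F (x(k := y)) \<partial>lborel) \<partial>Pi\<^sub>M ?L (\<lambda>_. lborel))"
  proof (intro nn_integral_cong)
    fix x assume "x \<in> space (Pi\<^sub>M ?L (\<lambda>_. lborel :: real measure))"
    then show "(\<integral>\<^sup>+ y. F (x(k := y)) \<partial>lborel) = ennreal c * (\<integral>\<^sup>+ y. ?F (x(k := y)) \<partial>lborel)"
      using nn_integral_real_affine[of "\<lambda>y. F (x(k := y))" c 0] sect[OF F] \<open>0 < c\<close> by simp
  qed
  also have "\<dots> = ennreal c * (\<integral>\<^sup>+ x. \<integral>\<^sup>+ y. ?F (x(k := y)) \<partial>lborel \<partial>Pi\<^sub>M ?L (\<lambda>_. lborel))"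
    using meas by (rule nn_integral_cmult)
  also have "\<dots> = ennreal c * (\<integral>\<^sup>+ \<mu>. ?F \<mu> \<partial>Pi\<^sub>M K (\<lambda>_. lborel))"
    using split[OF F'] by simp
  finally show ?thesis .
qed

section \<open>The level set of an affine family\<close>

lemma gradient_affine: "gradient (\<lambda>x. a \<bullet> x - b) x = (a :: 'a::real_inner)"
  unfolding gradient_def gderiv_def
proof (rule the_equality)
  show der: "((\<lambda>x. a \<bullet> x - b) has_derivative (\<lambda>h. h \<bullet> a)) (at x)"
    by (auto intro!: derivative_eq_intros simp: inner_commute)
  fix d assume "((\<lambda>x. a \<bullet> x - b) has_derivative (\<lambda>h. h \<bullet> d)) (at x)"
  then have "(\<lambda>h. h \<bullet> d) = (\<lambda>h. h \<bullet> a)" using der by (rule has_derivative_unique)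
  then have "(d - a) \<bullet> (d - a) = 0" by (metis inner_diff_right right_minus_eq)
  then show "d = a" by simp
qed

lemma at_within_interval_neq_bot:
  fixes I :: "real set"
  assumes "is_interval I" "interior I \<noteq> {}" "t \<in> I"
  shows "at t within I \<noteq> bot"
proof -
  have "I \<noteq> {t}" using assms(2) by auto
  then have "t islimpt I"
    using assms connected_imp_perfect[of I t] by (auto simp: is_interval_connected)
  then show ?thesis by (simp add: trivial_limit_within)
qed

lemma vector_derivative_affine_family:
  fixes f :: "real \<Rightarrow> 'a::real_inner"
  assumes I: "is_interval I" "interior I \<noteq> {}" "t \<in> I"
    and G: "\<And>s. s \<in> I \<Longrightarrow> G s x = f s \<bullet> x - f0 s"
    and C1: "C1_near I t f" "C1_near I t f0"
  shows "vector_derivative (\<lambda>s. G s x) (at t within I)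
    = vector_derivative f (at t within I) \<bullet> x - vector_derivative f0 (at t within I)"
proof -
  have diff: "(g has_vector_derivative vector_derivative g (at t within I)) (at t within I)"
    if "C1_near I t g" for g :: "real \<Rightarrow> 'c::real_normed_vector"
    using that \<open>t \<in> I\<close> by (auto simp: C1_near_def vector_derivative_works[symmetric])
  have "((\<lambda>s. f s \<bullet> x) has_vector_derivative vector_derivative f (at t within I) \<bullet> x) (at t within I)"
    by (rule bounded_linear.has_vector_derivative[OF bounded_linear_inner_left diff[OF C1(1)]])
  then have "((\<lambda>s. f s \<bullet> x - f0 s) has_vector_derivative
      vector_derivative f (at t within I) \<bullet> x - vector_derivative f0 (at t within I)) (at t within I)"
    by (intro has_vector_derivative_diff diff[OF C1(2)])
  then have "((\<lambda>s. G s x) has_vector_derivative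
      vector_derivative f (at t within I) \<bullet> x - vector_derivative f0 (at t within I)) (at t within I)"
    by (rule has_vector_derivative_transform[rotated 2]) (use G \<open>t \<in> I\<close> in auto)
  then show ?thesis
    by (rule vector_derivative_within[OF at_within_interval_neq_bot[OF I]])
qed

lemma two_row_matrix_mult: "vector [a, a'] *v x = (vector [a \<bullet> x, a' \<bullet> x] :: real ^ 2)"
  by (simp add: vec_eq_iff forall_2 matrix_vector_mul_component)

lemma two_row_transpose_mult:
  fixes a a' :: "real ^ 'n"
  shows "transpose (vector [a, a'] :: real ^ 'n ^ 2) *v v = v $ 1 *\<^sub>R a + v $ 2 *\<^sub>R a'"
  by (simp add: vec_eq_iff matrix_vector_mult_def transpose_def sum_2 mult.commute)

text \<open>Equality in the Cauchy-Schwarz inequality would put both rows on one line.\<close>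

lemma two_row_full_rank:
  fixes a a' :: "real ^ 'n"
  assumes "rank (vector [a, a'] :: real ^ 'n ^ 2) = 2"
  shows "2 \<le> CARD('n)" "(a \<bullet> a')\<^sup>2 < (a \<bullet> a) * (a' \<bullet> a')"
proof -
  let ?D = "vector [a, a'] :: real ^ 'n ^ 2"
  have "rows ?D = (\<lambda>i. ?D $ i) ` UNIV" by (auto simp: rows_def row_def)
  then have "rows ?D = {a, a'}" by (simp add: UNIV_2)
  then have dim: "dim {a, a'} = 2" using assms by (simp add: row_rank_def)
  have "dim {a, a'} \<le> CARD('n)" using dim_subset_UNIV[of "{a, a'}"] by simp
  then show "2 \<le> CARD('n)" using dim by simp
  have no_span: "\<not> {a, a'} \<subseteq> span {v}" for v
  proof
    assume "{a, a'} \<subseteq> span {v}"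
    then have "dim {a, a'} \<le> card {v}" by (rule dim_le_card) simp
    then show False using dim by simp
  qed
  have "(a \<bullet> a')\<^sup>2 \<noteq> (a \<bullet> a) * (a' \<bullet> a')"
  proof
    assume eq: "(a \<bullet> a')\<^sup>2 = (a \<bullet> a) * (a' \<bullet> a')"
    have "a \<noteq> 0" using no_span[of a'] by (auto simp: span_zero span_base)
    let ?z = "(a \<bullet> a) *\<^sub>R a' - (a \<bullet> a') *\<^sub>R a"
    have "?z \<bullet> ?z = (a \<bullet> a) * ((a \<bullet> a) * (a' \<bullet> a') - (a \<bullet> a')\<^sup>2)"
      by (simp add: inner_diff_left inner_diff_right inner_commute[of a' a] power2_eq_square algebra_simps)
    then have "?z = 0" using eq by simp
    then have "a' = ((a \<bullet> a') / (a \<bullet> a)) *\<^sub>R a"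
      using \<open>a \<noteq> 0\<close> by (metis divide_inverse_commute eq_iff_diff_eq_0 inner_eq_zero_iff scaleR_scaleR
          left_inverse scaleR_one)
    then have "a' \<in> span {a}" by (metis span_base span_scale singletonI)
    then show False using no_span[of a] by (simp add: span_base)
  qed
  then show "(a \<bullet> a')\<^sup>2 < (a \<bullet> a) * (a' \<bullet> a')"
    using Cauchy_Schwarz_ineq[of a a'] by simp
qed

text \<open>The determinant of the Gram matrix of \<open>a\<close> and \<open>a'\<close> is the defect in the Cauchy-Schwarz inequality,
so the matrix is invertible; then \<open>W\<close> solves the two linear equations. The
representation as a linear combination of the rows is what makes \<open>W\<close> orthogonal to the columns of \<open>J\<close>.\<close>

lemma least_norm_solution:
  fixes a a' :: "real ^ 'n"
  defines "D \<equiv> vector [a, a'] :: real ^ 'n ^ 2"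
  assumes W: "W = (transpose D ** matrix_inv (D ** transpose D)) *v vector [b, b']"
    and det: "(a \<bullet> a')\<^sup>2 < (a \<bullet> a) * (a' \<bullet> a')"
  obtains \<alpha> \<beta> where "W = \<alpha> *\<^sub>R a + \<beta> *\<^sub>R a'" "a \<bullet> W = b" "a' \<bullet> W = b'"
proof -
  let ?v = "matrix_inv (D ** transpose D) *v vector [b, b']"
  have Wv: "W = transpose D *v ?v" by (simp add: W matrix_vector_mul_assoc)
  have gram: "(D ** transpose D) *v v = vector [a \<bullet> (v $ 1 *\<^sub>R a + v $ 2 *\<^sub>R a'), a' \<bullet> (v $ 1 *\<^sub>R a + v $ 2 *\<^sub>R a')]" for v
    by (simp only: matrix_vector_mul_assoc[symmetric] D_def two_row_transpose_mult two_row_matrix_mult)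
  have "det (D ** transpose D) = (a \<bullet> a) * (a' \<bullet> a') - (a \<bullet> a')\<^sup>2"
  proof -
    have "(D ** transpose D) $ i $ j = D $ i \<bullet> D $ j" for i j
      by (simp add: matrix_matrix_mult_def transpose_def inner_vec_def)
    then show ?thesis
      by (simp add: det_2 D_def power2_eq_square inner_commute)
  qed
  then have "invertible (D ** transpose D)" using det by (simp add: invertible_det_nz)
  then have "(D ** transpose D) ** matrix_inv (D ** transpose D) = mat 1"
    unfolding invertible_def matrix_inv_def by (rule someI2_ex) blast
  then have "(D ** transpose D) *v ?v = vector [b, b']"
    by (simp add: matrix_vector_mul_assoc)
  then have "D *v W = vector [b, b']" by (simp add: Wv matrix_vector_mul_assoc matrix_mul_assoc)
  then have sol: "a \<bullet> W = b" "a' \<bullet> W = b'"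
    unfolding D_def two_row_matrix_mult by (metis vector_2)+
  have "W = (?v $ 1) *\<^sub>R a + (?v $ 2) *\<^sub>R a'"
    unfolding Wv unfolding D_def by (rule two_row_transpose_mult)
  then show thesis using sol by (rule that)
qed

theorem lemma4:
  fixes I :: "real set" and t :: real
    and f :: "real \<Rightarrow> real ^ 'n" and f\<^sub>0 :: "real \<Rightarrow> real"
    and G :: "real \<Rightarrow> real ^ 'n \<Rightarrow> real"
    and \<rho> :: "real ^ 'n \<Rightarrow> real"
    and a a' :: "real ^ 'n" and b b' :: real
    and D :: "real ^ 'n ^ 2"
    and J Z :: "nat \<Rightarrow> real ^ 'n"
    and W :: "real ^ 'n"
    and S U q :: real
    and n :: nat
  assumes n: "n = CARD('n)"
    and I: "is_interval I" "interior I \<noteq> {}" "t \<in> I"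
    and G: "\<And>s x. s \<in> I \<Longrightarrow> G s x = f s \<bullet> x - f\<^sub>0 s"
    and \<rho>: "prob_density \<rho>"
    and C1: "C1_near I t f" "C1_near I t f\<^sub>0"
    and a: "a = f t" and a': "a' = vector_derivative f (at t within I)"
    and b: "b = f\<^sub>0 t" and b': "b' = vector_derivative f\<^sub>0 (at t within I)"
    and D: "D = vector [a, a']"
    and full_rank: "rank D = 2"
    and DJ: "\<And>j. j \<in> {1..n - 2} \<Longrightarrow> D *v J j = 0"
    and JJ: "\<And>i j. i \<in> {1..n - 2} \<Longrightarrow> j \<in> {1..n - 2} \<Longrightarrow> J i \<bullet> J j = (if i = j then 1 else 0)"
    and W: "W = (transpose D ** matrix_inv (D ** transpose D)) *v vector [b, b']"
    and Z1: "Z 1 = a' - ((a \<bullet> a') / (a \<bullet> a)) *\<^sub>R a"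
    and ZJ: "\<And>j. j \<in> {1..n - 2} \<Longrightarrow> Z (j + 1) = J j"
    and S: "S = ((a' \<bullet> a') * (a \<bullet> a) - (a' \<bullet> a)\<^sup>2) / (a \<bullet> a)"
    and U: "U = W \<bullet> W"
    and q: "q = b' - ((a \<bullet> a') / (a \<bullet> a)) * b"
  shows "level_set_integral I G \<rho> t =
           ennreal (S powr (3 / 2) / norm a) *
           (\<integral>\<^sup>+ \<mu>. ennreal (\<rho> (W + mult_columns (n - 1) Z \<mu>) * \<bar>\<mu> 1\<bar>) \<partial>lebesgue_space (n - 1))
       \<and> U = (norm (b *\<^sub>R a' - b' *\<^sub>R a))\<^sup>2 / (S * (norm a)\<^sup>2)
       \<and> (\<forall>\<rho>h :: real \<Rightarrow> real. (\<forall>x. \<rho> x = \<rho>h (x \<bullet> x)) \<longrightarrow>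
           level_set_integral I G \<rho> t =
             ennreal (S powr (3 / 2) / norm a) *
             (\<integral>\<^sup>+ \<mu>. ennreal (\<rho>h (U + 2 * q * \<mu> 1 + S * (\<mu> 1)\<^sup>2 + (L2_set \<mu> {2..n - 1})\<^sup>2) * \<bar>\<mu> 1\<bar>)
                \<partial>lebesgue_space (n - 1)))"
proof -
  note One_nat_def [simp del]
  have D2: "rank (vector [a, a'] :: real ^ 'n ^ 2) = 2" using full_rank D by simp
  note n2 = two_row_full_rank(1)[OF D2] and det = two_row_full_rank(2)[OF D2]
  have aa: "0 < a \<bullet> a"
    using det by (metis inner_gt_zero_iff inner_zero_left mult_zero_left power2_less_0)
  then have a0: "a \<noteq> 0" by auto
  have S_det: "S * (a \<bullet> a) = (a \<bullet> a) * (a' \<bullet> a') - (a \<bullet> a')\<^sup>2"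
    using aa by (simp add: S inner_commute mult.commute)
  then have S0: "0 < S" using det aa by (metis diff_gt_0_iff_gt zero_less_mult_pos2)
  obtain \<alpha> \<beta> where W_span: "W = \<alpha> *\<^sub>R a + \<beta> *\<^sub>R a'" and aW: "a \<bullet> W = b" and a'W: "a' \<bullet> W = b'"
    using least_norm_solution[OF W[unfolded D] det] by blast
  have aJ: "a \<bullet> J j = 0" "a' \<bullet> J j = 0" if "j \<in> {1..n - 2}" for j
    using DJ[OF that] unfolding D two_row_matrix_mult by (metis vector_2 zero_index)+
  have aZ1: "a \<bullet> Z 1 = 0" using aa unfolding Z1 by (simp add: inner_diff_right)
  have a'Z1: "a' \<bullet> Z 1 = S"
    using aa unfolding Z1 by (simp add: S inner_diff_right inner_commute[of a' a] power2_eq_square field_simps)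
  have Z1Z1: "Z 1 \<bullet> Z 1 = S"
  proof -
    have "Z 1 \<bullet> Z 1 = a' \<bullet> Z 1 - ((a \<bullet> a') / (a \<bullet> a)) * (a \<bullet> Z 1)"
      by (subst (1) Z1) (simp add: inner_diff_left)
    then show ?thesis by (simp add: aZ1 a'Z1)
  qed
  have ZJ': "Z i = J (i - 1)" "i - 1 \<in> {1..n - 2}" if "i \<in> {2..n - 1}" for i
  proof -
    show 1: "i - 1 \<in> {1..n - 2}" using that by auto
    show "Z i = J (i - 1)" using ZJ[OF 1] that by simp
  qed
  have aZ: "a \<bullet> Z i = 0" "a' \<bullet> Z i = 0" if "i \<in> {2..n - 1}" for i
    using aJ ZJ'[OF that] by auto
  have Z1Z: "Z 1 \<bullet> Z i = 0" if "i \<in> {2..n - 1}" for i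
    using aZ[OF that] unfolding Z1 by (simp add: inner_diff_left)
  have ZZ: "Z i \<bullet> Z j = (if i = j then 1 else 0)" if "i \<in> {2..n - 1}" "j \<in> {2..n - 1}" for i j
    using ZJ'[OF that(1)] ZJ'[OF that(2)] JJ[of "i - 1" "j - 1"] that by auto
  have WZ1: "W \<bullet> Z 1 = q"
    using aW a'W unfolding Z1 by (simp add: q inner_diff_right inner_commute[of W])
  have WZ: "W \<bullet> Z i = 0" if "i \<in> {2..n - 1}" for i
    using aZ[OF that] by (simp add: W_span inner_add_left)
  have one: "1 \<in> {1..n - 1}" using n2 n by auto
  then have Iic: "{1..n - 1} = insert 1 {2..n - 1}" by auto
  have Zmu: "mult_columns (n - 1) Z \<mu> = \<mu> 1 *\<^sub>R Z 1 + (\<Sum>i = 2..n - 1. \<mu> i *\<^sub>R Z i)" for \<mu>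
    unfolding mult_columns_def Iic by (subst sum.insert) auto

  \<comment> \<open>Only the first column of \<open>Z\<close> needs to be normalised.\<close>
  define u where "u i = (if i = 1 then (1 / sqrt S) *\<^sub>R Z 1 else Z i)" for i :: nat
  have uu: "u i \<bullet> u j = (if i = j then 1 else 0)" if "i \<in> {1..n - 1}" "j \<in> {1..n - 1}" for i j
  proof -
    have 11: "u 1 \<bullet> u 1 = 1" using S0 by (simp add: u_def Z1Z1)
    have 1: "u 1 \<bullet> u k = 0" "u k \<bullet> u 1 = 0" if "k \<in> {2..n - 1}" for k
      using Z1Z[OF that] that by (auto simp: u_def inner_commute[of _ "Z 1"])
    have 2: "u k \<bullet> u l = (if k = l then 1 else 0)" if "k \<in> {2..n - 1}" "l \<in> {2..n - 1}" for k l
      using ZZ[OF that] that by (auto simp: u_def)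
    show ?thesis
      using that 11 1 2 unfolding Iic by fastforce
  qed
  have au: "a \<bullet> u i = 0" if "i \<in> {1..n - 1}" for i
    using that aZ1 aZ[of i] by (auto simp: u_def Iic)
  define g where "g x = ennreal (\<rho> x * (\<bar>a' \<bullet> x - b'\<bar> / norm a))" for x
  have \<rho>m [measurable]: "\<rho> \<in> borel_measurable borel" and \<rho>0: "\<And>x. 0 \<le> \<rho> x"
    using \<rho> by (auto simp: prob_density_def)
  have gm [measurable]: "g \<in> borel_measurable borel" unfolding g_def by measurable
  have Gt: "G t = (\<lambda>x. a \<bullet> x - b)" using G[OF I(3)] by (auto simp: a b)
  have integrand: "\<bar>vector_derivative (\<lambda>s. G s x) (at t within I)\<bar> / norm (gradient (G t) x)
      = \<bar>a' \<bullet> x - b'\<bar> / norm a" for x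
    unfolding Gt gradient_affine a' b'
    by (subst vector_derivative_affine_family[OF I G C1]) auto
  let ?P = "lebesgue_space (n - 1)"
  have "level_set_integral I G \<rho> t = (\<integral>\<^sup>+ x\<in>{x. a \<bullet> x = b}. g x \<partial>hausdorff_measure (CARD('n) - 1))"
    unfolding level_set_integral_def integrand g_def by (simp add: Gt)
  also have "\<dots> = (\<integral>\<^sup>+ \<nu>. g (W + (\<Sum>i = 1..n - 1. \<nu> i *\<^sub>R u i)) \<partial>?P)"
    using n2 a0 aW uu au gm by (intro nn_integral_hausdorff_hyperplane) (auto simp: n)
  also have "\<dots> = ennreal (sqrt S) *
      (\<integral>\<^sup>+ \<mu>. g (W + (\<Sum>i = 1..n - 1. (\<mu>(1 := sqrt S * \<mu> 1)) i *\<^sub>R u i)) \<partial>?P)"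
    using one S0 by (intro nn_integral_PiM_rescale) auto
  also have "(\<lambda>\<mu>. \<Sum>i = 1..n - 1. (\<mu>(1 := sqrt S * \<mu> 1)) i *\<^sub>R u i) = mult_columns (n - 1) Z"
  proof
    fix \<mu> :: "nat \<Rightarrow> real"
    show "(\<Sum>i = 1..n - 1. (\<mu>(1 := sqrt S * \<mu> 1)) i *\<^sub>R u i) = mult_columns (n - 1) Z \<mu>"
      unfolding mult_columns_def using S0 by (intro sum.cong refl) (auto simp: u_def)
  qed
  also have "(\<integral>\<^sup>+ \<mu>. g (W + mult_columns (n - 1) Z \<mu>) \<partial>?P)
      = (\<integral>\<^sup>+ \<mu>. ennreal (S / norm a) * ennreal (\<rho> (W + mult_columns (n - 1) Z \<mu>) * \<bar>\<mu> 1\<bar>) \<partial>?P)"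
  proof (rule nn_integral_cong)
    fix \<mu> :: "nat \<Rightarrow> real"
    have "a' \<bullet> (W + mult_columns (n - 1) Z \<mu>) - b' = S * \<mu> 1"
      using a'W a'Z1 aZ by (simp add: Zmu inner_add_right inner_sum_right)
    then show "g (W + mult_columns (n - 1) Z \<mu>)
        = ennreal (S / norm a) * ennreal (\<rho> (W + mult_columns (n - 1) Z \<mu>) * \<bar>\<mu> 1\<bar>)"
      using S0 \<rho>0 by (simp add: g_def ennreal_mult[symmetric] abs_mult mult_ac)
  qed
  also have "\<dots> = ennreal (S / norm a) *
      (\<integral>\<^sup>+ \<mu>. ennreal (\<rho> (W + mult_columns (n - 1) Z \<mu>) * \<bar>\<mu> 1\<bar>) \<partial>?P)"
  proof (rule nn_integral_cmult)
    have [measurable]: "(\<lambda>\<mu>. \<mu> i) \<in> borel_measurable ?P" if "i \<in> {1..n - 1}" for i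
      using measurable_component_singleton[OF that, of "\<lambda>_. lborel :: real measure"] by simp
    have [measurable]: "mult_columns (n - 1) Z \<in> borel_measurable ?P"
      unfolding mult_columns_def by measurable
    show "(\<lambda>\<mu>. ennreal (\<rho> (W + mult_columns (n - 1) Z \<mu>) * \<bar>\<mu> 1\<bar>)) \<in> borel_measurable ?P"
      using one by measurable
  qed
  also have "ennreal (sqrt S) * (ennreal (S / norm a) * X) = ennreal (S powr (3 / 2) / norm a) * X" for X
  proof -
    have "S powr (3 / 2) = sqrt S * S"
      using S0 powr_add[of S "1/2" 1] by (simp add: powr_half_sqrt)
    then show ?thesis using S0 by (simp add: mult.assoc[symmetric] ennreal_mult[symmetric])
  qed
  finally have part1: "level_set_integral I G \<rho> t = ennreal (S powr (3 / 2) / norm a) *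
      (\<integral>\<^sup>+ \<mu>. ennreal (\<rho> (W + mult_columns (n - 1) Z \<mu>) * \<bar>\<mu> 1\<bar>) \<partial>?P)" .

  have part2: "U = (norm (b *\<^sub>R a' - b' *\<^sub>R a))\<^sup>2 / (S * (norm a)\<^sup>2)"
  proof -
    \<comment> \<open>The coefficients \<open>\<alpha>\<close> and \<open>\<beta>\<close> are eliminated by substituting the two linear equations, which turns the claim into a polynomial identity.\<close>
    let ?x = "a \<bullet> a'" and ?y = "a' \<bullet> a'" and ?r = "a \<bullet> a"
    have b_eq: "b = \<alpha> * ?r + \<beta> * ?x" and b'_eq: "b' = \<alpha> * ?x + \<beta> * ?y"
      using aW a'W by (auto simp: W_span inner_add_right inner_commute[of a' a])
    have "U = \<alpha> * b + \<beta> * b'"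
      unfolding U by (subst (1) W_span) (simp add: inner_add_left aW a'W)
    then have "U * (?r * ?y - ?x\<^sup>2) = b\<^sup>2 * ?y - 2 * b * b' * ?x + b'\<^sup>2 * ?r"
      unfolding b_eq b'_eq by algebra
    also have "\<dots> = (norm (b *\<^sub>R a' - b' *\<^sub>R a))\<^sup>2"
      unfolding power2_norm_eq_inner
      by (simp add: inner_diff_left inner_diff_right inner_commute[of a' a] power2_eq_square algebra_simps)
    finally have "U * (S * (norm a)\<^sup>2) = (norm (b *\<^sub>R a' - b' *\<^sub>R a))\<^sup>2"
      unfolding power2_norm_eq_inner[of a] S_det .
    then show ?thesis using S0 a0 by (simp add: eq_divide_eq)
  qed

  have quad: "(W + mult_columns (n - 1) Z \<mu>) \<bullet> (W + mult_columns (n - 1) Z \<mu>)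
      = U + 2 * q * \<mu> 1 + S * (\<mu> 1)\<^sup>2 + (L2_set \<mu> {2..n - 1})\<^sup>2" for \<mu>
  proof -
    let ?R = "\<Sum>i = 2..n - 1. \<mu> i *\<^sub>R Z i"
    have "?R \<bullet> ?R = (\<Sum>i = 2..n - 1. \<mu> i * \<mu> i)"
      by (rule orthonormal_sum_inner) (auto simp: ZZ)
    also have "\<dots> = (L2_set \<mu> {2..n - 1})\<^sup>2"
      by (simp add: L2_set_def sum_nonneg power2_eq_square)
    finally have RR: "?R \<bullet> ?R = (L2_set \<mu> {2..n - 1})\<^sup>2" .
    have WR: "W \<bullet> ?R = 0" and ZR: "Z 1 \<bullet> ?R = 0"
      using WZ Z1Z by (auto simp: inner_sum_right)
    have expand: "(w + (m *\<^sub>R z + r)) \<bullet> (w + (m *\<^sub>R z + r))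
        = w \<bullet> w + 2 * (w \<bullet> z) * m + (z \<bullet> z) * m\<^sup>2 + r \<bullet> r + 2 * (w \<bullet> r) + 2 * m * (z \<bullet> r)"
      for w z r :: "real ^ 'n" and m
      by (simp add: inner_add_left inner_add_right inner_commute[of r w] inner_commute[of r z] inner_commute[of z w]
          power2_eq_square algebra_simps)
    show ?thesis
      unfolding Zmu expand RR WR ZR WZ1 Z1Z1 U by simp
  qed
  have part3: "level_set_integral I G \<rho> t = ennreal (S powr (3 / 2) / norm a) *
      (\<integral>\<^sup>+ \<mu>. ennreal (\<rho>h (U + 2 * q * \<mu> 1 + S * (\<mu> 1)\<^sup>2 + (L2_set \<mu> {2..n - 1})\<^sup>2) * \<bar>\<mu> 1\<bar>) \<partial>?P)"
    if "\<forall>x. \<rho> x = \<rho>h (x \<bullet> x)" for \<rho>h :: "real \<Rightarrow> real"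
    unfolding part1 by (simp only: that quad)
  show ?thesis using part1 part2 part3 by blast
qed

end
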